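(* Consider the VIP network described in the context, with arrival processes satisfying assumptions (i)--(iii) there and arrival rate vector $\boldsymbol\lambda=(\lambda_n^k)_{n\in\mathcal N,k\in\mathcal K}$. Given $\boldsymbol\epsilon=(\epsilon_n^k)_{n\in\mathcal N,k\in\mathcal K}\succeq\mathbf 0$ such that $\boldsymbol\lambda+\boldsymbol\epsilon\in\mathrm{int}(\Lambda)$, there exist $\boldsymbol\delta=(\delta_n^k)_{n\in\mathcal N,k\in\mathcal K}\succ\mathbf 0$ such that $\boldsymbol\lambda+\boldsymbol\epsilon+\boldsymbol\delta\in\Lambda$, and $\mathbf z=(z_n^k)_{n\in\mathcal N,k\in\mathcal K}\succ\mathbf 0$ (entries in $(0,\infty]$, with $1/\infty=0$) such that $$\boldsymbol\epsilon_{z}\triangleq\left(\frac{2C_{\max}L^k+Nr_{\max}}{z_n^k}\right)_{n\in\mathcal N,k\in\mathcal K}\preceq\boldsymbol\epsilon .$$ Then the network of VIP queues under the Enhanced Forwarding and Caching algorithm (defined in the context, with bias function using the parameters $\mathbf z$) satisfies $$\limsup_{t\to\infty}\frac1t\sum_{\tau=1}^{t}\ \sum_{n\in\mathcal N,k\in\mathcal K}\mathbb E[V_n^k(\tau)]\ \le\ \frac{NB}{\beta_z},$$ where $$B\triangleq\frac1{2N}\sum_{n\in\mathcal N}\Big((\mu^{out}_{n,\max})^2+(A_{n,\max}+\mu^{in}_{n,\max}+Kr_n)^2+2\mu^{out}_{n,\max}Kr_n\Big),$$ $$\beta_z\triangleq\sup_{\{(\boldsymbol\epsilon',\boldsymbol\delta'):\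 \boldsymbol\epsilon'\succ\boldsymbol\epsilon_z,\ \boldsymbol\delta'\succ\mathbf 0,\ \boldsymbol\lambda+\boldsymbol\epsilon'+\boldsymbol\delta'\in\Lambda\}}\ \min_{n\in\mathcal N,k\in\mathcal K}\left\{\epsilon_n'^{k}+\delta_n'^{k}-\frac{2C_{\max}L^k+Nr_{\max}}{z_n^k}\right\},$$ with $\mu^{in}_{n,\max}\triangleq\sum_{a\in\mathcal N}C_{an}/D$, $\mu^{out}_{n,\max}\triangleq\sum_{b\in\mathcal N}C_{nb}/D$, $A_{n,\max}\triangleq\sum_{k\in\mathcal K}A^k_{n,\max}$ and $r_{\max}\triangleq\max_{n\in\mathcal N}r_n$.
   Context: **Network.** $\mathcal G=(\mathcal N,\mathcal L)$ is a connected directed graph with $N=|\mathcal N|$ nodes and a finite set $\mathcal L$ of directed links, such that $(b,a)\in\mathcal L$ whenever $(a,b)\in\mathcal L$. Link $(a,b)\in\mathcal L$ has capacity $C_{ab}>0$ (in sums over all nodes, $C_{ab}=0$ if $(a,b)\notin\mathcal L$). Node $n$ has cache size $L_n\ge 0$. There is a finite set $\mathcal K$ of $K$ data objects, all of size $D$, with $L_n<KD$ for all $n$. Each $k\in\mathcal K$ has a unique source node $src(k)\in\mathcal N$. For each $k$, $\mathcal L^k\subseteq\mathcal L$ is the set of links allowed to carry the virtual interest packets (VIPs) of object $k$, and $L^k=|\mathcal L^k|$. $r_n$ is the maximum rate (objects per slot) at which node $n$ can produce copies of a cached object. $C_{\max}\triangleq\max_{(a,b)\in\mathcal L}C_{ab}/D$.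 **Actions.** Time is slotted, $t=1,2,\dots$. In slot $t$, $\mu_{ab}^k(t)\ge0$ is the transmission rate allocated to VIPs of object $k$ over link $(a,b)$, subject to $\sum_{k}\mu_{ab}^k(t)\le C_{ba}/D$ for all $(a,b)\in\mathcal L$ (capacity of the reverse link) and $\mu^k_{ab}(t)=0$ for $(a,b)\notin\mathcal L^k$; $s_n^k(t)\in\{0,1\}$ is the caching state, subject to $\sum_k s_n^k(t)\le L_n/D$. A joint forwarding and caching policy is feasible if its actions satisfy these constraints. **VIP queues.** $A_n^k(t)$ is the number of exogenous VIP arrivals at node $n$ for object $k$ in slot $t$. The VIP counts $V_n^k(t)\ge0$ are real, $V_n^k(1)=0$, $V_n^k(t)=0$ for all $t\ge1$ if $n=src(k)$, and $$V_n^k(t+1)\le\Big(\big(V_n^k(t)-\textstyle\sum_{b\in\mathcal N}\mu_{nb}^k(t)\big)^++A_n^k(t)+\sum_{a\in\mathcal N}\mu_{an}^k(t)-r_ns_n^k(t)\Big)^+,\qquad (x)^+=\max(x,0).$$ Write $\mathbf V(t)=(V_n^k(t))_{n,k}$. **Arrival assumptions.** (i) The processes $\{A_n^k(t)\}_{t\ge1}$ are mutually independent with respect to $n$ and $k$; (ii) for each $n,k$ the variables $A_n^k(t)$ are i.i.d. in $t$; (iii) $A_n^k(t)\le A_{n,\max}^k$ for all $t$. The arrival rates are $\lambda_n^k\triangleq\limsup_{t\to\infty}\frac1t\sum_{\tau=1}^tA_n^k(\tau)$. **Stability region.** A queue $V_n^k$ is stable if $\limsup_{t\to\infty}\frac1t\sum_{\tau=1}^t\Pr[V_n^k(\tau)>\xi]\to0$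 as $\xi\to\infty$. The VIP network stability region $\Lambda$ is the closure of the set of all arrival rate vectors $\boldsymbol\lambda=(\lambda_n^k)$ for which there exists a feasible joint forwarding and caching policy which can guarantee that all VIP queues are stable. $\mathrm{int}(\Lambda)$ is its interior. $\succeq,\preceq$ (resp. $\succ,\prec$) denote componentwise (resp. componentwise strict) inequalities. **Bias function.** For $\mathbf v=(v_n^k)$ and parameters $\mathbf z=(z_n^k)$, $f_n^k(\mathbf v)=\sum_{n'\in\mathcal N}\eta_{nn'}^k(\mathbf v)\,v_{n'}^k/z_{n'}^k$, where the weights $\eta^k_{nn'}(\mathbf v)\in[0,1]$ are given functions of $\mathbf v$. **Enhanced Forwarding and Caching algorithm.** At the beginning of each slot $t$, observe $\mathbf V(t)$. *Forwarding:* for each object $k$ and each link $(a,b)\in\mathcal L^k$ let $W_{ab}^k(t)=\big(V_a^k(t)+f_a^k(\mathbf V(t))\big)-\big(V_b^k(t)+f_b^k(\mathbf V(t))\big)$, $k^*_{ab}(t)=\arg\max_{k:(a,b)\in\mathcal L^k}W_{ab}^k(t)$ and $W_{ab}^*(t)=\big(W_{ab}^{k^*_{ab}(t)}(t)\big)^+$. Set $\mu_{ab}^k(t)=C_{ba}/D$ if $W^*_{ab}(t)>0$ and $k=k^*_{ab}(t)$, and $\mu_{ab}^k(t)=0$ otherwise. *Caching:* at each node $n$, choose $(s_n^k(t))_{k}\in\{0,1\}^{\mathcal K}$ maximizing $\sum_k\big(V_n^k(t)+f_n^k(\mathbf V(t))\big)s_n^k$ subject to $\sum_ks_n^k\le L_n/D$.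 The VIP counts are then updated according to the dynamics above. *)

theory Defs
  imports "HOL-Probability.Probability"
begin

text \<open>
  Nodes are the elements of the finite type \<open>'n\<close>, data objects those of the finite type \<open>'k\<close>;
  a vector indexed by (node, object) has type \<open>real^'k^'n\<close> and entries \<open>v $ n $ k\<close>.
\<close>

record ('n, 'k) vip_network =
  links :: "('n \<times> 'n) set"
  cap :: "'n \<Rightarrow> 'n \<Rightarrow> real"
  cache_size :: "'n \<Rightarrow> real"
  obj_size :: real
  src :: "'k \<Rightarrow> 'n"
  obj_links :: "'k \<Rightarrow> ('n \<times> 'n) set"
  cache_rate :: "'n \<Rightarrow> real"

definition vip_network :: "('n::finite, 'k::finite) vip_network \<Rightarrow> bool" where
  "vip_network G \<longleftrightarrow>
     0 < obj_size G \<and>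
     (\<forall>a b. (a, b) \<in> links G \<longrightarrow> (b, a) \<in> links G) \<and>
     (\<forall>a b. (a, b) \<in> (links G)\<^sup>*) \<and>
     (\<forall>a b. (a, b) \<in> links G \<longrightarrow> 0 < cap G a b) \<and>
     (\<forall>a b. (a, b) \<notin> links G \<longrightarrow> cap G a b = 0) \<and>
     (\<forall>n. 0 \<le> cache_size G n \<and> cache_size G n < real CARD('k) * obj_size G) \<and>
     (\<forall>k. obj_links G k \<subseteq> links G) \<and>
     (\<forall>n. 0 \<le> cache_rate G n)"

text \<open>Irrelevant if there are no links: it is only used multiplied by the number of links of an object.\<close>

definition C_max :: "('n::finite, 'k::finite) vip_network \<Rightarrow> real" where
  "C_max G = Max {cap G a b / obj_size G | a b. (a, b) \<in> links G}"

definition r_max :: "('n::finite, 'k::finite) vip_network \<Rightarrow> real" where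
  "r_max G = Max (range (cache_rate G))"


subsection \<open>Actions and queue dynamics\<close>

text \<open>Interest packets on \<open>(a, b)\<close> are limited by the capacity of the reverse link \<open>(b, a)\<close>.\<close>

definition feasible_forwarding ::
  "('n::finite, 'k::finite) vip_network \<Rightarrow> ('n \<Rightarrow> 'n \<Rightarrow> 'k \<Rightarrow> real) \<Rightarrow> bool" where
  "feasible_forwarding G \<mu> \<longleftrightarrow>
     (\<forall>a b k. 0 \<le> \<mu> a b k) \<and>
     (\<forall>a b. (a, b) \<in> links G \<longrightarrow> (\<Sum>k\<in>UNIV. \<mu> a b k) \<le> cap G b a / obj_size G) \<and>
     (\<forall>a b k. (a, b) \<notin> obj_links G k \<longrightarrow> \<mu> a b k = 0)"

definition feasible_caching_at ::
  "('n::finite, 'k::finite) vip_network \<Rightarrow> 'n \<Rightarrow> ('k \<Rightarrow> real) \<Rightarrow> bool" where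
  "feasible_caching_at G n x \<longleftrightarrow>
     (\<forall>k. x k \<in> {0, 1}) \<and> (\<Sum>k\<in>UNIV. x k) \<le> cache_size G n / obj_size G"

text \<open>
  A sample path of the virtual queues. Time starts at 1; values at time 0 play no role.
  The recursion is an inequality, so \<open>V\<close> is not determined by arrivals and actions.
\<close>

definition vip_dynamics ::
  "('n::finite, 'k::finite) vip_network \<Rightarrow> (nat \<Rightarrow> real^'k^'n) \<Rightarrow>
   (nat \<Rightarrow> 'n \<Rightarrow> 'n \<Rightarrow> 'k \<Rightarrow> real) \<Rightarrow> (nat \<Rightarrow> 'n \<Rightarrow> 'k \<Rightarrow> real) \<Rightarrow> (nat \<Rightarrow> real^'k^'n) \<Rightarrow> bool" where
  "vip_dynamics G A \<mu> s V \<longleftrightarrow>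
     (\<forall>n k. V 1 $ n $ k = 0) \<and>
     (\<forall>t\<ge>1. \<forall>n k.
        0 \<le> V t $ n $ k \<and>
        (n = src G k \<longrightarrow> V t $ n $ k = 0) \<and>
        V (Suc t) $ n $ k \<le>
          max 0 (max 0 (V t $ n $ k - (\<Sum>b\<in>UNIV. \<mu> t n b k))
                 + A t $ n $ k + (\<Sum>a\<in>UNIV. \<mu> t a n k) - cache_rate G n * s t n k))"


subsection \<open>Arrivals\<close>

definition arrival_process ::
  "'w measure \<Rightarrow> (nat \<Rightarrow> 'w \<Rightarrow> real^'k::finite^'n::finite) \<Rightarrow> real^'k^'n \<Rightarrow> bool" where
  "arrival_process M A A_max \<longleftrightarrow>
     prob_space.indep_vars M (\<lambda>_. Pi\<^sub>M {1..} (\<lambda>_. borel))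
       (\<lambda>(n, k) \<omega>. \<lambda>t\<in>{1..}. A t \<omega> $ n $ k) UNIV \<and>
     (\<forall>n k. prob_space.indep_vars M (\<lambda>_. borel) (\<lambda>t \<omega>. A t \<omega> $ n $ k) {1..}) \<and>
     (\<forall>n k. \<forall>t\<ge>1. distr M borel (\<lambda>\<omega>. A t \<omega> $ n $ k) = distr M borel (\<lambda>\<omega>. A 1 \<omega> $ n $ k)) \<and>
     (\<forall>n k. \<forall>t\<ge>1. \<forall>\<omega>\<in>space M. 0 \<le> A t \<omega> $ n $ k \<and> A t \<omega> $ n $ k \<le> A_max $ n $ k)"

definition has_arrival_rates ::
  "'w measure \<Rightarrow> (nat \<Rightarrow> 'w \<Rightarrow> real^'k::finite^'n::finite) \<Rightarrow> real^'k^'n \<Rightarrow> bool" where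
  "has_arrival_rates M A lam \<longleftrightarrow>
     (AE \<omega> in M. \<forall>n k.
        limsup (\<lambda>t. ereal ((1 / real t) * (\<Sum>\<tau>=1..t. A \<tau> \<omega> $ n $ k))) = ereal (lam $ n $ k))"


subsection \<open>Policies and the stability region\<close>

definition stable_queue :: "'w measure \<Rightarrow> (nat \<Rightarrow> 'w \<Rightarrow> real) \<Rightarrow> bool" where
  "stable_queue M Q \<longleftrightarrow>
     ((\<lambda>\<xi>::real. limsup (\<lambda>t. ereal ((1 / real t) *
         (\<Sum>\<tau>=1..t. measure M {\<omega> \<in> space M. Q \<tau> \<omega> > \<xi>})))) \<longlongrightarrow> 0) at_top"

text \<open>
  A policy is a causal, possibly randomized rule. In slot \<open>t\<close> it maps the queue lengths
  observed in slots \<open>1..t\<close>, the arrivals observed in slots \<open>1..t-1\<close> and its private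
  random seed to a forwarding and a caching action. Causality is enforced by passing
  truncated histories to the rule.
\<close>

record ('n, 'k) vip_policy =
  seed :: "(nat \<Rightarrow> real) measure"
  fwd_rule :: "nat \<Rightarrow> (nat \<Rightarrow> real^'k^'n) \<Rightarrow> (nat \<Rightarrow> real^'k^'n) \<Rightarrow> (nat \<Rightarrow> real) \<Rightarrow> 'n \<Rightarrow> 'n \<Rightarrow> 'k \<Rightarrow> real"
  cache_rule :: "nat \<Rightarrow> (nat \<Rightarrow> real^'k^'n) \<Rightarrow> (nat \<Rightarrow> real^'k^'n) \<Rightarrow> (nat \<Rightarrow> real) \<Rightarrow> 'n \<Rightarrow> 'k \<Rightarrow> real"

definition before :: "nat \<Rightarrow> (nat \<Rightarrow> 'a::zero) \<Rightarrow> nat \<Rightarrow> 'a" where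
  "before t x = (\<lambda>\<tau>. if 1 \<le> \<tau> \<and> \<tau> < t then x \<tau> else 0)"

definition feasible_policy ::
  "('n::finite, 'k::finite) vip_network \<Rightarrow> ('n, 'k) vip_policy \<Rightarrow> bool" where
  "feasible_policy G \<pi> \<longleftrightarrow>
     prob_space (seed \<pi>) \<and> sets (seed \<pi>) = sets (Pi\<^sub>M UNIV (\<lambda>_. borel)) \<and>
     (\<forall>t\<ge>1.
        (\<forall>a b k. (\<lambda>(hV, hA, u). fwd_rule \<pi> t hV hA u a b k) \<in> borel_measurable
           (Pi\<^sub>M UNIV (\<lambda>_. borel) \<Otimes>\<^sub>M Pi\<^sub>M UNIV (\<lambda>_. borel) \<Otimes>\<^sub>M seed \<pi>)) \<and>
        (\<forall>n k. (\<lambda>(hV, hA, u). cache_rule \<pi> t hV hA u n k) \<in> borel_measurable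
           (Pi\<^sub>M UNIV (\<lambda>_. borel) \<Otimes>\<^sub>M Pi\<^sub>M UNIV (\<lambda>_. borel) \<Otimes>\<^sub>M seed \<pi>)) \<and>
        (\<forall>hV hA u.
           feasible_forwarding G (fwd_rule \<pi> t hV hA u) \<and>
           (\<forall>n. feasible_caching_at G n (cache_rule \<pi> t hV hA u n))))"

definition runs_under ::
  "('n::finite, 'k::finite) vip_network \<Rightarrow> ('n, 'k) vip_policy \<Rightarrow> 'w measure \<Rightarrow>
   (nat \<Rightarrow> 'w \<Rightarrow> real^'k^'n) \<Rightarrow> ('w \<Rightarrow> nat \<Rightarrow> real) \<Rightarrow> (nat \<Rightarrow> 'w \<Rightarrow> real^'k^'n) \<Rightarrow> bool" where
  "runs_under G \<pi> M A U V \<longleftrightarrow>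
     U \<in> M \<rightarrow>\<^sub>M seed \<pi> \<and> distr M (seed \<pi>) U = seed \<pi> \<and>
     prob_space.indep_set M
       (sets (vimage_algebra (space M) U (seed \<pi>)))
       (sets (vimage_algebra (space M) (\<lambda>\<omega>. \<lambda>t\<in>{1..}. A t \<omega>) (Pi\<^sub>M {1..} (\<lambda>_. borel)))) \<and>
     (\<forall>t\<ge>1. V t \<in> borel_measurable M) \<and>
     (\<forall>\<omega>\<in>space M.
        vip_dynamics G (\<lambda>t. A t \<omega>)
          (\<lambda>t. fwd_rule \<pi> t (before (Suc t) (\<lambda>\<tau>. V \<tau> \<omega>)) (before t (\<lambda>\<tau>. A \<tau> \<omega>)) (U \<omega>))
          (\<lambda>t. cache_rule \<pi> t (before (Suc t) (\<lambda>\<tau>. V \<tau> \<omega>)) (before t (\<lambda>\<tau>. A \<tau> \<omega>)) (U \<omega>))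
          (\<lambda>t. V t \<omega>))"

text \<open>
  The policy has to stabilize the queues for every arrival process of the given rates and
  for every queue process compatible with the dynamics. The sample space
  \<open>nat \<Rightarrow> real\<close>, with an arbitrary \<open>\<sigma>\<close>-algebra and measure, can carry any countable family
  of real random variables, so fixing this type is no restriction.
\<close>

definition guarantees_stability ::
  "('n::finite, 'k::finite) vip_network \<Rightarrow> ('n, 'k) vip_policy \<Rightarrow> real^'k^'n \<Rightarrow> bool" where
  "guarantees_stability G \<pi> lam \<longleftrightarrow>
     (\<forall>(M :: (nat \<Rightarrow> real) measure) A A_max U V.
        prob_space M \<and> arrival_process M A A_max \<and> has_arrival_rates M A lam \<and>
        runs_under G \<pi> M A U V \<longrightarrow>
        (\<forall>n k. stable_queue M (\<lambda>t \<omega>. V t \<omega> $ n $ k)))"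

text \<open>Arrival rate vectors are exactly the entrywise nonnegative ones.\<close>

definition stability_region :: "('n::finite, 'k::finite) vip_network \<Rightarrow> (real^'k^'n) set" where
  "stability_region G =
     closure {lam. (\<forall>n k. 0 \<le> lam $ n $ k) \<and>
                   (\<exists>\<pi>. feasible_policy G \<pi> \<and> guarantees_stability G \<pi> lam)}"


subsection \<open>The enhanced forwarding and caching algorithm\<close>

text \<open>
  The parameters \<open>z\<close> range over \<open>(0, \<infinity>]\<close>; on \<open>ereal\<close>, \<open>x / \<infinity> = 0\<close> for finite \<open>x\<close>, so both
  uses of \<open>real_of_ereal\<close> below are applied to finite values.
\<close>

definition bias ::
  "('n::finite \<Rightarrow> 'n \<Rightarrow> 'k::finite \<Rightarrow> real^'k^'n \<Rightarrow> real) \<Rightarrow> ('n \<Rightarrow> 'k \<Rightarrow> ereal) \<Rightarrow>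
   real^'k^'n \<Rightarrow> 'n \<Rightarrow> 'k \<Rightarrow> real" where
  "bias \<eta> z v n k = (\<Sum>n'\<in>UNIV. \<eta> n n' k v * real_of_ereal (ereal (v $ n' $ k) / z n' k))"

definition efc_weight ::
  "('n::finite \<Rightarrow> 'n \<Rightarrow> 'k::finite \<Rightarrow> real^'k^'n \<Rightarrow> real) \<Rightarrow> ('n \<Rightarrow> 'k \<Rightarrow> ereal) \<Rightarrow>
   real^'k^'n \<Rightarrow> 'n \<Rightarrow> 'n \<Rightarrow> 'k \<Rightarrow> real" where
  "efc_weight \<eta> z v a b k = (v $ a $ k + bias \<eta> z v a k) - (v $ b $ k + bias \<eta> z v b k)"

text \<open>Ties in both maximizations may be broken arbitrarily.\<close>

definition efc_forwarding ::
  "('n::finite, 'k::finite) vip_network \<Rightarrow> ('n \<Rightarrow> 'n \<Rightarrow> 'k \<Rightarrow> real^'k^'n \<Rightarrow> real) \<Rightarrow>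
   ('n \<Rightarrow> 'k \<Rightarrow> ereal) \<Rightarrow> real^'k^'n \<Rightarrow> ('n \<Rightarrow> 'n \<Rightarrow> 'k \<Rightarrow> real) \<Rightarrow> bool" where
  "efc_forwarding G \<eta> z v \<mu> \<longleftrightarrow>
     (\<forall>a b.
        if \<exists>k. (a, b) \<in> obj_links G k
        then \<exists>k'. is_arg_max (efc_weight \<eta> z v a b) (\<lambda>k. (a, b) \<in> obj_links G k) k' \<and>
               (\<forall>k. \<mu> a b k =
                  (if max 0 (efc_weight \<eta> z v a b k') > 0 \<and> k = k'
                   then cap G b a / obj_size G else 0))
        else \<forall>k. \<mu> a b k = 0)"

definition efc_caching ::
  "('n::finite, 'k::finite) vip_network \<Rightarrow> ('n \<Rightarrow> 'n \<Rightarrow> 'k \<Rightarrow> real^'k^'n \<Rightarrow> real) \<Rightarrow>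
   ('n \<Rightarrow> 'k \<Rightarrow> ereal) \<Rightarrow> real^'k^'n \<Rightarrow> ('n \<Rightarrow> 'k \<Rightarrow> real) \<Rightarrow> bool" where
  "efc_caching G \<eta> z v s \<longleftrightarrow>
     (\<forall>n. is_arg_max (\<lambda>x. \<Sum>k\<in>UNIV. (v $ n $ k + bias \<eta> z v n k) * x k)
            (feasible_caching_at G n) (s n))"

text \<open>
  \<open>F t\<close> is the information available at the beginning of slot \<open>t\<close>: queue lengths
  and actions of slot \<open>t\<close> are determined by it and the exogenous arrivals of slot \<open>t\<close> are
  independent of it. This must be stated explicitly because the inequality in the dynamics
  would otherwise allow \<open>V t\<close> to anticipate future arrivals.
\<close>

definition efc_process ::
  "('n::finite, 'k::finite) vip_network \<Rightarrow> ('n \<Rightarrow> 'n \<Rightarrow> 'k \<Rightarrow> real^'k^'n \<Rightarrow> real) \<Rightarrow>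
   ('n \<Rightarrow> 'k \<Rightarrow> ereal) \<Rightarrow> 'w measure \<Rightarrow> (nat \<Rightarrow> 'w measure) \<Rightarrow> (nat \<Rightarrow> 'w \<Rightarrow> real^'k^'n) \<Rightarrow>
   (nat \<Rightarrow> 'w \<Rightarrow> 'n \<Rightarrow> 'n \<Rightarrow> 'k \<Rightarrow> real) \<Rightarrow> (nat \<Rightarrow> 'w \<Rightarrow> 'n \<Rightarrow> 'k \<Rightarrow> real) \<Rightarrow>
   (nat \<Rightarrow> 'w \<Rightarrow> real^'k^'n) \<Rightarrow> bool" where
  "efc_process G \<eta> z M F A \<mu> s V \<longleftrightarrow>
     filtration (space M) F \<and> (\<forall>t. subalgebra M (F t)) \<and>
     (\<forall>t\<ge>1.
        V t \<in> borel_measurable (F t) \<and>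
        (\<forall>a b k. (\<lambda>\<omega>. \<mu> t \<omega> a b k) \<in> borel_measurable (F t)) \<and>
        (\<forall>n k. (\<lambda>\<omega>. s t \<omega> n k) \<in> borel_measurable (F t)) \<and>
        prob_space.indep_set M (sets (vimage_algebra (space M) (A t) borel)) (sets (F t))) \<and>
     (\<forall>\<omega>\<in>space M.
        vip_dynamics G (\<lambda>t. A t \<omega>) (\<lambda>t. \<mu> t \<omega>) (\<lambda>t. s t \<omega>) (\<lambda>t. V t \<omega>) \<and>
        (\<forall>t\<ge>1. efc_forwarding G \<eta> z (V t \<omega>) (\<mu> t \<omega>) \<and> efc_caching G \<eta> z (V t \<omega>) (s t \<omega>)))"


subsection \<open>The constants of the bound\<close>

definition eps_z ::
  "('n::finite, 'k::finite) vip_network \<Rightarrow> ('n \<Rightarrow> 'k \<Rightarrow> ereal) \<Rightarrow> real^'k^'n" where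
  "eps_z G z = (\<chi> n k. real_of_ereal
     (ereal (2 * C_max G * real (card (obj_links G k)) + real CARD('n) * r_max G) / z n k))"

definition mu_in_max :: "('n::finite, 'k::finite) vip_network \<Rightarrow> 'n \<Rightarrow> real" where
  "mu_in_max G n = (\<Sum>a\<in>UNIV. cap G a n) / obj_size G"

definition mu_out_max :: "('n::finite, 'k::finite) vip_network \<Rightarrow> 'n \<Rightarrow> real" where
  "mu_out_max G n = (\<Sum>b\<in>UNIV. cap G n b) / obj_size G"

definition bound_B :: "('n::finite, 'k::finite) vip_network \<Rightarrow> real^'k^'n \<Rightarrow> real" where
  "bound_B G A_max = 1 / (2 * real CARD('n)) *
     (\<Sum>n\<in>UNIV. (mu_out_max G n)\<^sup>2
        + ((\<Sum>k\<in>UNIV. A_max $ n $ k) + mu_in_max G n + real CARD('k) * cache_rate G n)\<^sup>2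
        + 2 * mu_out_max G n * real CARD('k) * cache_rate G n)"

text \<open>
  The supremum is taken in \<open>ereal\<close>. It is infinite for a network with a single node (the source
  of every object), whose stability region is unbounded in every coordinate.
\<close>

definition beta_z ::
  "('n::finite, 'k::finite) vip_network \<Rightarrow> real^'k^'n \<Rightarrow> ('n \<Rightarrow> 'k \<Rightarrow> ereal) \<Rightarrow> ereal" where
  "beta_z G lam z =
     (SUP (eps', del') \<in>
        {(eps', del'). (\<forall>n k. eps' $ n $ k > eps_z G z $ n $ k) \<and> (\<forall>n k. del' $ n $ k > 0) \<and>
                       lam + eps' + del' \<in> stability_region G}.
        ereal (MIN (n, k)\<in>UNIV. eps' $ n $ k + del' $ n $ k - eps_z G z $ n $ k))"

end

theory Submission
  imports Defs
begin

text \<open>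
  The proof is a Lyapunov drift argument. A load vector in the stability region can be served, up to
  an arbitrarily small error, by a time average of feasible actions: run a stabilizing policy with
  constant arrivals and stop at a late slot in which all queues are bounded. The enhanced algorithm
  maximizes the weighted service for the biased queue lengths, so its service weighted by the true
  queue lengths beats that of every feasible action, hence of every such average, up to the
  perturbation \<open>eps_z\<close>.

  The usual Lyapunov function \<open>\<Sum> V\<^sup>2\<close> yields the constant \<open>B\<close> with the two flow bounds interchanged:
  interests use the capacity of the reverse link, so outflow is bounded by \<open>mu_in_max\<close> and
  inflow by \<open>mu_out_max\<close>. With \<open>\<Sum> (V\<^sup>2 - 2 * m * V)\<close>, where \<open>m\<close> is the mean arrival, the cross
  term of arrivals and inflow becomes one of arrivals and outflow, and the stated \<open>B\<close> suffices.
\<close>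

text \<open>Stability is promised for every arrival process of the given rates, in particular for
  deterministic arrivals, and the seed measure itself can serve as the probability space. Then only
  the seed is random, and fixing one seed and one late slot turns the policy into a finite list of
  feasible actions. No stationary randomized policy has to be built from the stabilizing one: with
  the queue vector frozen, the objective of the algorithm is linear in the service, so comparison
  with each action of the list gives comparison with their average. The mean arrivals enter the
  drift only through being at most \<open>lam\<close>; as queue lengths are nonnegative, this
  one-sided information is enough. The price of the linear term in the Lyapunov function is that
  \<open>V\<^sup>2 - 2 * m * V\<close> decreases for \<open>V\<close> below \<open>m\<close>. An
  upper bound on the next queue length therefore does not bound its Lyapunov value directly, and the
  amount by which the queue falls short of the recursion has to be tracked.\<close>

section \<open>Deterministic arrivals as a degenerate arrival process\<close>

lemma (in prob_space) indep_sets_trivial: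
  assumes "\<And>i. i \<in> I \<Longrightarrow> F i \<subseteq> {{}, space M}"
  shows "indep_sets F I"
  unfolding indep_sets_def
proof (intro conjI ballI allI impI)
  show "F i \<subseteq> events" if "i \<in> I" for i using assms[OF that] by auto
  fix J B assume J: "J \<subseteq> I" "J \<noteq> {}" "finite J" "B \<in> Pi J F"
  then have B: "B j = {} \<or> B j = space M" if "j \<in> J" for j using assms that by blast
  show "prob (\<Inter>j\<in>J. B j) = (\<Prod>j\<in>J. prob (B j))"
  proof (cases "\<exists>j\<in>J. B j = {}")
    case True
    then obtain j where j: "j \<in> J" "B j = {}" by blast
    then have "(\<Inter>j\<in>J. B j) = {}" by auto
    moreover have "(\<Prod>j\<in>J. prob (B j)) = 0"
      using j J(3) by (intro prod_zero bexI[of _ j]) auto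
    ultimately show ?thesis by simp
  next
    case False
    with B have "\<And>j. j \<in> J \<Longrightarrow> B j = space M" by blast
    with J show ?thesis by (simp add: prob_space)
  qed
qed

lemma (in prob_space) indep_vars_const:
  assumes "\<And>i. i \<in> I \<Longrightarrow> c i \<in> space (N i)"
  shows "indep_vars N (\<lambda>i _. c i) I"
  unfolding indep_vars_def2
  using assms by (auto intro!: indep_sets_trivial)

text \<open>Constant arrivals generate the trivial sigma-algebra, which is independent of
  everything; this supplies the independence of seed and arrivals demanded by
  \<open>runs_under\<close>.\<close>

lemma (in prob_space) indep_set_trivial:
  assumes "E \<subseteq> events" "E' \<subseteq> {{}, space M}"
  shows "indep_set E E'"
proof (rule indep_setI)
  show "E \<subseteq> events" "E' \<subseteq> events" using assms by auto
  fix a b assume "a \<in> E" "b \<in> E'"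
  then have "a \<in> events" "b = {} \<or> b = space M" using assms by auto
  then show "prob (a \<inter> b) = prob a * prob b"
    by (auto simp: prob_space sets.Int_space_eq2)
qed

lemma borel_measurable_vec_lambda2:
  assumes "\<And>n k. (\<lambda>\<omega>. f \<omega> n k) \<in> borel_measurable M"
  shows "(\<lambda>\<omega>. (\<chi> n k. f \<omega> n k) :: real^'k::finite^'n::finite) \<in> borel_measurable M"
  using assms
  by (subst borel_measurable_euclidean_space) (auto simp: Basis_vec_def inner_axis)

lemma borel_measurable_vec_nth2:
  assumes "f \<in> borel_measurable M"
  shows "(\<lambda>\<omega>. (f \<omega> :: real^'k::finite^'n::finite) $ n $ k) \<in> borel_measurable M"
  by (rule borel_measurable_continuous_on[OF _ assms, of "\<lambda>v. v $ n $ k"])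
     (intro continuous_intros)

text \<open>Makes a constant load an admissible instance in \<open>guarantees_stability\<close>:
  degenerate variables are independent, and the load vector is its own upper bound.\<close>

lemma arrival_process_const:
  assumes "prob_space M"
  shows "arrival_process M (\<lambda>_ _. lam) lam \<longleftrightarrow> (\<forall>n k. 0 \<le> lam $ n $ k)"
proof -
  interpret prob_space M by fact
  have 1: "indep_vars (\<lambda>_. Pi\<^sub>M {1..} (\<lambda>_. borel)) (\<lambda>(n, k) \<omega>. \<lambda>t\<in>{1::nat..}. lam $ n $ k) UNIV"
    using indep_vars_const[of UNIV "\<lambda>(n, k). \<lambda>t\<in>{1::nat..}. lam $ n $ k" "\<lambda>_. Pi\<^sub>M {1..} (\<lambda>_. borel)"]
    by (auto simp: space_PiM split: prod.splits cong: if_cong) (simp add: case_prod_unfold)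
  have 2: "indep_vars (\<lambda>_. borel) (\<lambda>t \<omega>. lam $ n $ k) {1::nat..}" for n k
    by (rule indep_vars_const) auto
  show ?thesis using 1 2 not_empty unfolding arrival_process_def by auto
qed

lemma has_arrival_rates_const: "has_arrival_rates M (\<lambda>_ _. lam) lam"
proof -
  have "limsup (\<lambda>t. ereal ((1 / real t) * (\<Sum>\<tau>=1..t. c))) = ereal c" for c :: real
  proof (rule lim_imp_Limsup)
    have "(\<lambda>t. ereal c) \<longlonglongrightarrow> ereal c" by simp
    then show "(\<lambda>t. ereal ((1 / real t) * (\<Sum>\<tau>=1..t. c))) \<longlonglongrightarrow> ereal c"
      by (rule Lim_transform_eventually)
         (rule eventually_mono[OF eventually_gt_at_top[of 0]], simp)
  qed simp
  then show ?thesis unfolding has_arrival_rates_def by simp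
qed

section \<open>Service of load vectors in the stability region\<close>

text \<open>The run of a policy in which the inequality of the queue dynamics is an equality.\<close>

primrec vip_history ::
  "('n::finite, 'k::finite) vip_network \<Rightarrow> ('n, 'k) vip_policy \<Rightarrow> (nat \<Rightarrow> real^'k^'n) \<Rightarrow>
   (nat \<Rightarrow> real) \<Rightarrow> nat \<Rightarrow> nat \<Rightarrow> real^'k^'n" where
  "vip_history G \<pi> A u 0 = (\<lambda>_. 0)"
| "vip_history G \<pi> A u (Suc t) = (vip_history G \<pi> A u t)(Suc t :=
     (if t = 0 then 0 else
       (let h = vip_history G \<pi> A u t;
            \<mu> = fwd_rule \<pi> t h (before t A) u; s = cache_rule \<pi> t h (before t A) u in
        \<chi> n k. if n = src G k then 0 else
          max 0 (max 0 (h t $ n $ k - (\<Sum>b\<in>UNIV. \<mu> n b k))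
                 + A t $ n $ k + (\<Sum>a\<in>UNIV. \<mu> a n k) - cache_rate G n * s n k))))"

text \<open>A rule reads the whole past, so the recursion carries the history as a function of time
  and the path is read off its diagonal. The history is zero outside the slots already computed,
  hence it is literally the truncation that \<open>runs_under\<close> passes to the rules.\<close>

definition vip_run ::
  "('n::finite, 'k::finite) vip_network \<Rightarrow> ('n, 'k) vip_policy \<Rightarrow> (nat \<Rightarrow> real^'k^'n) \<Rightarrow>
   (nat \<Rightarrow> real) \<Rightarrow> nat \<Rightarrow> real^'k^'n" where
  "vip_run G \<pi> A u t = vip_history G \<pi> A u t t"

lemma vip_history_eq: "vip_history G \<pi> A u t = before (Suc t) (vip_run G \<pi> A u)"
proof (induction t)
  case (Suc t)
  show ?case
  proof
    fix \<tau>
    show "vip_history G \<pi> A u (Suc t) \<tau> = before (Suc (Suc t)) (vip_run G \<pi> A u) \<tau>"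
    proof (cases "\<tau> = Suc t")
      case True
      then show ?thesis by (simp add: before_def vip_run_def)
    next
      case False
      then have "vip_history G \<pi> A u (Suc t) \<tau> = vip_history G \<pi> A u t \<tau>" by simp
      then show ?thesis using Suc False by (auto simp: before_def)
    qed
  qed
qed (auto simp: before_def)

lemma vip_run_1: "vip_run G \<pi> A u (Suc 0) = 0"
  by (simp add: vip_run_def)

lemma vip_run_Suc:
  assumes "1 \<le> t"
  shows "vip_run G \<pi> A u (Suc t) =
    (let \<mu> = fwd_rule \<pi> t (before (Suc t) (vip_run G \<pi> A u)) (before t A) u;
         s = cache_rule \<pi> t (before (Suc t) (vip_run G \<pi> A u)) (before t A) u in
        \<chi> n k. if n = src G k then 0 else
          max 0 (max 0 (vip_run G \<pi> A u t $ n $ k - (\<Sum>b\<in>UNIV. \<mu> n b k))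
                 + A t $ n $ k + (\<Sum>a\<in>UNIV. \<mu> a n k) - cache_rate G n * s n k))"
proof -
  have *: "before (Suc t) (vip_run G \<pi> A u) t = vip_run G \<pi> A u t"
    using assms by (simp add: before_def)
  then show ?thesis
    using assms unfolding vip_run_def[of G \<pi> A u "Suc t"] vip_history.simps
    unfolding vip_history_eq by (simp add: Let_def * cong: if_cong)
qed

text \<open>With the arrivals fixed, the path is a function of the seed alone. The induction is
  course-of-values because the action in a slot depends on all earlier queue lengths, not only on
  the last one.\<close>

lemma measurable_vip_run:
  assumes "feasible_policy G \<pi>"
  shows "(\<lambda>u. vip_run G \<pi> A u t) \<in> borel_measurable (seed \<pi>)"
proof (induction t rule: less_induct)
  case (less t)
  consider "t = 0" | "t = 1" | t' where "t = Suc t'" "1 \<le> t'"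
    by (metis One_nat_def Suc_le_eq gr0I not0_implies_Suc)
  then show ?case
  proof cases
    case 1
    then show ?thesis by (simp add: vip_run_def)
  next
    case 2
    then show ?thesis by (simp add: vip_run_1)
  next
    case 3
    let ?h = "\<lambda>u. before (Suc t') (vip_run G \<pi> A u)"
    have m: "?h \<in> seed \<pi> \<rightarrow>\<^sub>M Pi\<^sub>M UNIV (\<lambda>_. borel)"
    proof (rule measurable_PiM_single')
      fix i show "(\<lambda>u. ?h u i) \<in> borel_measurable (seed \<pi>)"
        using less[of i] 3 by (cases "1 \<le> i \<and> i < Suc t'") (auto simp: before_def)
    qed auto
    have tr: "(\<lambda>u. (?h u, before t' A, u)) \<in> seed \<pi> \<rightarrow>\<^sub>M
      (Pi\<^sub>M UNIV (\<lambda>_. borel) \<Otimes>\<^sub>M Pi\<^sub>M UNIV (\<lambda>_. borel) \<Otimes>\<^sub>M seed \<pi>)"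
      by (intro measurable_Pair m measurable_const measurable_ident_sets) (auto simp: space_PiM)
    have f: "(\<lambda>u. fwd_rule \<pi> t' (?h u) (before t' A) u a b k) \<in> borel_measurable (seed \<pi>)" for a b k
      using measurable_compose[OF tr, of "\<lambda>(hV, hA, u). fwd_rule \<pi> t' hV hA u a b k" borel]
        assms 3 by (auto simp: feasible_policy_def)
    have c: "(\<lambda>u. cache_rule \<pi> t' (?h u) (before t' A) u n k) \<in> borel_measurable (seed \<pi>)" for n k
      using measurable_compose[OF tr, of "\<lambda>(hV, hA, u). cache_rule \<pi> t' hV hA u n k" borel]
        assms 3 by (auto simp: feasible_policy_def)
    have v: "(\<lambda>u. vip_run G \<pi> A u t' $ n $ k) \<in> borel_measurable (seed \<pi>)" for n k
      using less[of t'] 3 by (intro borel_measurable_vec_nth2) auto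
    show ?thesis
      unfolding 3(1) vip_run_Suc[OF 3(2)] Let_def
      by (intro borel_measurable_vec_lambda2 measurable_If borel_measurable_max borel_measurable_add
          borel_measurable_diff borel_measurable_sum borel_measurable_times measurable_const v f c)
        auto
  qed
qed


text \<open>The seed is the only source of randomness, so the seed measure is taken as the
  probability space and the identity as the seed variable. This fits
  \<open>guarantees_stability\<close>, whose sample spaces have the type of seeds.\<close>

lemma runs_under_vip_run:
  assumes "feasible_policy G \<pi>"
  shows "runs_under G \<pi> (seed \<pi>) (\<lambda>_ _. lam) (\<lambda>u. u) (\<lambda>t u. vip_run G \<pi> (\<lambda>_. lam) u t)"
proof -
  interpret prob_space "seed \<pi>" using assms by (simp add: feasible_policy_def)
  have "sets (vimage_algebra (space (seed \<pi>)) (\<lambda>\<omega>. \<lambda>t\<in>{1::nat..}. lam) (Pi\<^sub>M {1..} (\<lambda>_. borel)))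
      \<subseteq> {{}, space (seed \<pi>)}"
    by (auto simp: sets_vimage_algebra2 space_PiM)
  then have "indep_set (sets (vimage_algebra (space (seed \<pi>)) (\<lambda>u. u) (seed \<pi>)))
      (sets (vimage_algebra (space (seed \<pi>)) (\<lambda>\<omega>. \<lambda>t\<in>{1::nat..}. lam) (Pi\<^sub>M {1..} (\<lambda>_. borel))))"
    by (intro indep_set_trivial) (auto simp: sets_vimage_algebra2)
  moreover have "vip_dynamics G (\<lambda>t. lam)
     (\<lambda>t. fwd_rule \<pi> t (before (Suc t) (vip_run G \<pi> (\<lambda>_. lam) u)) (before t (\<lambda>\<tau>. lam)) u)
     (\<lambda>t. cache_rule \<pi> t (before (Suc t) (vip_run G \<pi> (\<lambda>_. lam) u)) (before t (\<lambda>\<tau>. lam)) u)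
     (vip_run G \<pi> (\<lambda>_. lam) u)" for u
    unfolding vip_dynamics_def
  proof (intro conjI allI impI)
    fix n k
    show "vip_run G \<pi> (\<lambda>_. lam) u 1 $ n $ k = 0" by (simp add: vip_run_1)
    fix t :: nat assume t: "1 \<le> t"
    have *: "0 \<le> vip_run G \<pi> (\<lambda>_. lam) u t $ n $ k
      \<and> (n = src G k \<longrightarrow> vip_run G \<pi> (\<lambda>_. lam) u t $ n $ k = 0)"
    proof (cases "t = 1")
      case True
      then show ?thesis by (simp add: vip_run_1)
    next
      case False
      then obtain t' where "t = Suc t'" "1 \<le> t'" using t by (cases t) auto
      then show ?thesis by (simp add: vip_run_Suc Let_def)
    qed
    then show "0 \<le> vip_run G \<pi> (\<lambda>_. lam) u t $ n $ k" ..
    show "vip_run G \<pi> (\<lambda>_. lam) u t $ n $ k = 0" if "n = src G k" using * that by blast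
  qed (simp add: vip_run_Suc Let_def)
  ultimately show ?thesis
    using measurable_vip_run[OF assms, of "\<lambda>_. lam"]
    unfolding runs_under_def by (simp add: distr_id)
qed

text \<open>If from some slot on every outcome had a queue above \<open>\<xi>\<close>, the overflow
  probabilities would sum to at least 1 in each such slot by the union bound. Stability makes the
  time average of each of them less than a quarter of its share \<open>1 / C\<close>, a
  contradiction over a long window.\<close>

lemma (in prob_space) stable_queues_jointly_bounded:
  fixes Q :: "'i::finite \<Rightarrow> nat \<Rightarrow> 'a \<Rightarrow> real"
  assumes stable: "\<And>i. stable_queue M (Q i)"
    and meas: "\<And>i t. 1 \<le> t \<Longrightarrow> Q i t \<in> borel_measurable M"
  obtains \<xi> where "\<And>T. \<exists>t\<ge>T. \<exists>\<omega>\<in>space M. \<forall>i. Q i t \<omega> \<le> \<xi>"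
proof -
  define C where "C = real CARD('i)"
  have C: "0 < C" by (simp add: C_def)
  have "\<forall>\<^sub>F \<xi> in at_top. limsup (\<lambda>t. ereal ((1 / real t) *
         (\<Sum>\<tau>=1..t. prob {\<omega> \<in> space M. Q i \<tau> \<omega> > \<xi>}))) < ereal (1 / (4 * C))" for i
    using stable[of i] C unfolding stable_queue_def by (intro order_tendstoD(2)) auto
  then have "\<forall>\<^sub>F \<xi> in at_top. \<forall>i. limsup (\<lambda>t. ereal ((1 / real t) *
         (\<Sum>\<tau>=1..t. prob {\<omega> \<in> space M. Q i \<tau> \<omega> > \<xi>}))) < ereal (1 / (4 * C))"
    by (rule eventually_all_finite)
  then obtain \<xi> :: real where \<xi>: "limsup (\<lambda>t. ereal ((1 / real t) *
         (\<Sum>\<tau>=1..t. prob {\<omega> \<in> space M. Q i \<tau> \<omega> > \<xi>}))) < ereal (1 / (4 * C))" for i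
    using eventually_happens'[OF trivial_limit_at_top_linorder] by blast
  have "\<forall>\<^sub>F t in sequentially. \<forall>i. ereal ((1 / real t) *
         (\<Sum>\<tau>=1..t. prob {\<omega> \<in> space M. Q i \<tau> \<omega> > \<xi>})) < ereal (1 / (4 * C))"
    by (intro eventually_all_finite Limsup_lessD \<xi>)
  then obtain N where N: "(1 / real t) *
         (\<Sum>\<tau>=1..t. prob {\<omega> \<in> space M. Q i \<tau> \<omega> > \<xi>}) < 1 / (4 * C)" if "N \<le> t" for t i
    unfolding eventually_sequentially by auto
  show thesis
  proof (rule that, rule ccontr)
    fix T assume "\<not> (\<exists>t\<ge>T. \<exists>\<omega>\<in>space M. \<forall>i. Q i t \<omega> \<le> \<xi>)"
    then have no: "\<exists>i. Q i t \<omega> > \<xi>" if "T \<le> t" "\<omega> \<in> space M" for t \<omega>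
      using that by (meson not_le)
    have one: "1 \<le> (\<Sum>i\<in>UNIV. prob {\<omega> \<in> space M. Q i t \<omega> > \<xi>})" if "T \<le> t" "1 \<le> t" for t
    proof -
      have ev: "{\<omega> \<in> space M. Q i t \<omega> > \<xi>} \<in> events" for i
        using meas[OF that(2), of i] by measurable
      have "1 = prob (\<Union>i\<in>UNIV. {\<omega> \<in> space M. Q i t \<omega> > \<xi>})"
        using no[OF that(1)] by (subst prob_space[symmetric]) (auto intro!: arg_cong[where f=prob])
      also have "\<dots> \<le> (\<Sum>i\<in>UNIV. prob {\<omega> \<in> space M. Q i t \<omega> > \<xi>})"
        using ev by (intro finite_measure_subadditive_finite) auto
      finally show ?thesis .
    qed
    \<comment> \<open>This choice gives \<open>N \<le> t\<close> and leaves at least half of the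
      slots up to \<open>t\<close> after \<open>T\<close>. The double sum is then at least
      \<open>t / 2\<close>, but by stability at most \<open>t / 4\<close>.\<close>
    define t where "t = N + 2 * T + 2"
    have "real t / 2 \<le> real (card {Suc T..t})"
      by (simp add: t_def)
    also have "\<dots> = (\<Sum>\<tau>\<in>{Suc T..t}. 1)"
      by simp
    also have "\<dots> \<le> (\<Sum>\<tau>\<in>{Suc T..t}. \<Sum>i\<in>UNIV. prob {\<omega> \<in> space M. Q i \<tau> \<omega> > \<xi>})"
      by (intro sum_mono one) auto
    also have "\<dots> \<le> (\<Sum>\<tau>\<in>{1..t}. \<Sum>i\<in>UNIV. prob {\<omega> \<in> space M. Q i \<tau> \<omega> > \<xi>})"
      by (intro sum_mono2) (auto intro!: sum_nonneg)
    also have "\<dots> = (\<Sum>i\<in>UNIV. \<Sum>\<tau>\<in>{1..t}. prob {\<omega> \<in> space M. Q i \<tau> \<omega> > \<xi>})"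
      by (rule sum.swap)
    also have "\<dots> \<le> (\<Sum>i\<in>(UNIV::'i set). real t / (4 * C))"
    proof (intro sum_mono)
      fix i
      have "0 < real t" by (simp add: t_def)
      then show "(\<Sum>\<tau>\<in>{1..t}. prob {\<omega> \<in> space M. Q i \<tau> \<omega> > \<xi>}) \<le> real t / (4 * C)"
        using N[of t i] by (simp add: t_def field_simps)
    qed
    also have "\<dots> = real t / 4"
      using C by (simp add: C_def)
    finally show False by (simp add: t_def)
  qed
qed

abbreviation net_service ::
  "('n::finite, 'k::finite) vip_network \<Rightarrow> ('n \<Rightarrow> 'n \<Rightarrow> 'k \<Rightarrow> real) \<Rightarrow> ('n \<Rightarrow> 'k \<Rightarrow> real) \<Rightarrow> 'n \<Rightarrow> 'k \<Rightarrow> real" where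
  "net_service G \<mu> s n k \<equiv> (\<Sum>b\<in>UNIV. \<mu> n b k) - (\<Sum>a\<in>UNIV. \<mu> a n k) + cache_rate G n * s n k"

text \<open>Dropping both positive parts of the recursion only lowers it, so away from the source a
  queue grows per slot by at least the arrivals minus \<open>net_service\<close>. Summing, total
  arrivals minus total service is at most the final queue length, which is bounded at arbitrarily
  late slots and so negligible against \<open>T\<close>. Half of \<open>\<xi>\<close> pays for this,
  the other half for passing to the closure. Source queues are held at zero and carry no information
  on service.\<close>

lemma stability_region_service:
  fixes G :: "('n::finite, 'k::finite) vip_network"
  assumes "lam \<in> stability_region G" "0 < \<xi>"
  obtains T :: nat and \<mu> s where "0 < T"
    "\<And>\<tau>. feasible_forwarding G (\<mu> \<tau>)" "\<And>\<tau> n. feasible_caching_at G n (s \<tau> n)"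
    "\<And>n k. n \<noteq> src G k \<Longrightarrow> real T * (lam $ n $ k - \<xi>) \<le>
       (\<Sum>\<tau>\<in>{1..T}. net_service G (\<mu> \<tau>) (s \<tau>) n k)"
proof -
  obtain lam' \<pi> where lam': "\<And>n k. 0 \<le> lam' $ n $ k" "feasible_policy G \<pi>"
      "guarantees_stability G \<pi> lam'" "dist lam' lam < \<xi> / 2"
    using assms unfolding stability_region_def closure_approachable
    by (smt (verit, best) half_gt_zero mem_Collect_eq)
  interpret prob_space "seed \<pi>" using lam'(2) by (simp add: feasible_policy_def)
  let ?V = "\<lambda>u. vip_run G \<pi> (\<lambda>_. lam') u"
  have run: "runs_under G \<pi> (seed \<pi>) (\<lambda>_ _. lam') (\<lambda>u. u) (\<lambda>t u. ?V u t)"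
    by (rule runs_under_vip_run) fact
  have stable: "stable_queue (seed \<pi>) (\<lambda>t u. ?V u t $ n $ k)" for n k
    using lam'(3) run arrival_process_const[OF prob_space_axioms, of lam'] lam'(1)
      has_arrival_rates_const[of "seed \<pi>" lam'] prob_space_axioms
    unfolding guarantees_stability_def by blast
  obtain C where C: "\<exists>t\<ge>T. \<exists>\<omega>\<in>space (seed \<pi>). \<forall>i. (case i of (n, k) \<Rightarrow> ?V \<omega> t $ n $ k) \<le> C" for T
  proof (rule stable_queues_jointly_bounded[of "\<lambda>i t u. case i of (n, k) \<Rightarrow> ?V u t $ n $ k"])
    fix i :: "'n \<times> 'k" and t
    obtain n k where i: "i = (n, k)" by (cases i)
    show "stable_queue (seed \<pi>) (\<lambda>t u. case i of (n, k) \<Rightarrow> ?V u t $ n $ k)"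
      by (simp add: i stable)
    show "(\<lambda>u. case i of (n, k) \<Rightarrow> ?V u t $ n $ k) \<in> borel_measurable (seed \<pi>)"
      by (simp add: i borel_measurable_vec_nth2 measurable_vip_run lam'(2))
  qed blast
  obtain T0 :: nat where T0: "C / (\<xi> / 2) < real T0" using reals_Archimedean2 by blast
  obtain t u where t: "T0 + 2 \<le> t" and V: "\<And>n k. ?V u t $ n $ k \<le> C"
    using C[of "T0 + 2"] by auto
  \<comment> \<open>The queue length in slot \<open>t\<close> records the arrivals and services of
    slots 1 to \<open>t - 1\<close>.\<close>
  define T where "T = t - 1"
  have T: "0 < T" "T0 \<le> T" "t = Suc T" using t by (auto simp: T_def)
  \<comment> \<open>Feasibility of the rules is known from slot 1 on; \<open>max 1\<close> extends
    it to index 0, as the claim is for all indices. The indices that are summed start at 1 and are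
    unaffected.\<close>
  define \<mu> where "\<mu> \<tau> = fwd_rule \<pi> (max 1 \<tau>) (before (Suc \<tau>) (?V u)) (before \<tau> (\<lambda>_. lam')) u" for \<tau>
  define s where "s \<tau> = cache_rule \<pi> (max 1 \<tau>) (before (Suc \<tau>) (?V u)) (before \<tau> (\<lambda>_. lam')) u" for \<tau>
  show thesis
  proof (rule that[of T \<mu> s])
    show "feasible_forwarding G (\<mu> \<tau>)" "feasible_caching_at G n (s \<tau> n)" for \<tau> n
      using lam'(2) by (auto simp: feasible_policy_def \<mu>_def s_def)
    fix n k assume nk: "n \<noteq> src G k"
    let ?d = "\<lambda>\<tau>. net_service G (\<mu> \<tau>) (s \<tau>) n k"
    have "lam' $ n $ k * real j - (\<Sum>\<tau>\<in>{1..j}. ?d \<tau>) \<le> ?V u (Suc j) $ n $ k" for j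
    proof (induction j)
      case 0
      then show ?case by (simp add: vip_run_1)
    next
      case (Suc j)
      have "?V u (Suc j) $ n $ k + lam' $ n $ k - ?d (Suc j) \<le> ?V u (Suc (Suc j)) $ n $ k"
        using nk by (simp add: vip_run_Suc[of "Suc j"] Let_def \<mu>_def s_def)
      with Suc show ?case by (simp add: algebra_simps)
    qed
    from this[of T] have "lam' $ n $ k * real T - (\<Sum>\<tau>\<in>{1..T}. ?d \<tau>) \<le> C"
      using V[of n k] T by simp
    moreover have "C \<le> \<xi> / 2 * real T"
      using T0 T(2) assms(2) by (simp add: field_simps)
         (smt (verit, best) mult_left_mono of_nat_mono)
    moreover have "lam $ n $ k - \<xi> / 2 \<le> lam' $ n $ k"
    proof -
      have "\<bar>(lam' - lam) $ n $ k\<bar> \<le> norm (lam' - lam)"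
        using component_le_norm_cart[of "(lam' - lam) $ n" k] Finite_Cartesian_Product.norm_nth_le[of "lam' - lam" n] by linarith
      then show ?thesis using lam'(4) by (simp add: dist_norm)
    qed
    then have "real T * (lam $ n $ k - \<xi> / 2) \<le> real T * lam' $ n $ k" by (intro mult_left_mono) auto
    ultimately show "real T * (lam $ n $ k - \<xi>) \<le> (\<Sum>\<tau>\<in>{1..T}. ?d \<tau>)"
      by (simp add: algebra_simps)
  qed (use T in auto)
qed

section \<open>Near-optimality of the enhanced algorithm\<close>

lemma cap_nonneg: "vip_network G \<Longrightarrow> 0 \<le> cap G a b / obj_size G"
  unfolding vip_network_def by (metis divide_nonneg_pos less_eq_real_def order_refl)

lemma cap_le_C_max:
  assumes "vip_network G" "(a, b) \<in> links G"
  shows "cap G a b / obj_size G \<le> C_max G"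
proof -
  have "{cap G a b / obj_size G | a b. (a, b) \<in> links G} = (\<lambda>(a, b). cap G a b / obj_size G) ` links G"
    by auto
  then have "finite {cap G a b / obj_size G | a b. (a, b) \<in> links G}"
    by simp
  then show ?thesis unfolding C_max_def using assms by (intro Max_ge) auto
qed

lemma feasible_forwarding_le:
  assumes G: "vip_network G" and f: "feasible_forwarding G \<mu>"
  shows "(\<Sum>k\<in>UNIV. \<mu> a b k) \<le> cap G b a / obj_size G"
proof (cases "(a, b) \<in> links G")
  case True
  then show ?thesis using f by (simp add: feasible_forwarding_def)
next
  case False
  then have "\<mu> a b k = 0" for k using f G unfolding feasible_forwarding_def vip_network_def by blast
  then show ?thesis using cap_nonneg[OF G] by simp
qed

lemma feasible_forwarding_out_le:
  assumes "vip_network G" "feasible_forwarding G \<mu>"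
  shows "(\<Sum>k\<in>UNIV. \<Sum>b\<in>UNIV. \<mu> n b k) \<le> mu_in_max G n"
  unfolding mu_in_max_def sum_divide_distrib
  by (subst sum.swap) (intro sum_mono feasible_forwarding_le assms)

lemma feasible_forwarding_in_le:
  assumes "vip_network G" "feasible_forwarding G \<mu>"
  shows "(\<Sum>k\<in>UNIV. \<Sum>a\<in>UNIV. \<mu> a n k) \<le> mu_out_max G n"
  unfolding mu_out_max_def sum_divide_distrib
  by (subst sum.swap) (intro sum_mono feasible_forwarding_le assms)

lemma efc_forwarding_feasible:
  assumes G: "vip_network G" and e: "efc_forwarding G \<eta> z v \<mu>"
  shows "feasible_forwarding G \<mu>"
proof -
  have *: "(\<forall>k. 0 \<le> \<mu> a b k) \<and> (\<Sum>k\<in>UNIV. \<mu> a b k) \<le> cap G b a / obj_size G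
      \<and> (\<forall>k. (a, b) \<notin> obj_links G k \<longrightarrow> \<mu> a b k = 0)" for a b
  proof (cases "\<exists>k. (a, b) \<in> obj_links G k")
    case True
    then obtain k' where k': "is_arg_max (efc_weight \<eta> z v a b) (\<lambda>k. (a, b) \<in> obj_links G k) k'"
      "\<And>k. \<mu> a b k = (if max 0 (efc_weight \<eta> z v a b k') > 0 \<and> k = k' then cap G b a / obj_size G else 0)"
      using e unfolding efc_forwarding_def by meson
    have "(\<Sum>k\<in>UNIV. \<mu> a b k) \<le> cap G b a / obj_size G"
      using cap_nonneg[OF G, of b a] by (cases "efc_weight \<eta> z v a b k' > 0") (simp_all add: k'(2))
    then show ?thesis using k' cap_nonneg[OF G, of b a] by (auto simp: is_arg_max_def)
  next
    case False
    then have "\<mu> a b k = 0" for k using e unfolding efc_forwarding_def by meson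
    then show ?thesis using cap_nonneg[OF G, of b a] by simp
  qed
  then show ?thesis unfolding feasible_forwarding_def by blast
qed

text \<open>On a single link every feasible action earns at most the capacity times the positive
  part of the largest weight, and the algorithm earns exactly that by giving the whole capacity to a
  maximizing object.\<close>

lemma efc_forwarding_optimal:
  assumes G: "vip_network G" and e: "efc_forwarding G \<eta> z v \<mu>" and f: "feasible_forwarding G \<mu>'"
  shows "(\<Sum>k\<in>UNIV. \<mu>' a b k * efc_weight \<eta> z v a b k) \<le> (\<Sum>k\<in>UNIV. \<mu> a b k * efc_weight \<eta> z v a b k)"
proof (cases "\<exists>k. (a, b) \<in> obj_links G k")
  case True
  then obtain k' where k': "is_arg_max (efc_weight \<eta> z v a b) (\<lambda>k. (a, b) \<in> obj_links G k) k'"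
    "\<And>k. \<mu> a b k = (if max 0 (efc_weight \<eta> z v a b k') > 0 \<and> k = k' then cap G b a / obj_size G else 0)"
    using e unfolding efc_forwarding_def by meson
  let ?W = "max 0 (efc_weight \<eta> z v a b k')"
  have "(\<Sum>k\<in>UNIV. \<mu>' a b k * efc_weight \<eta> z v a b k) \<le> (\<Sum>k\<in>UNIV. \<mu>' a b k * ?W)"
  proof (rule sum_mono)
    fix k
    show "\<mu>' a b k * efc_weight \<eta> z v a b k \<le> \<mu>' a b k * ?W"
    proof (cases "(a, b) \<in> obj_links G k")
      case True
      then have "efc_weight \<eta> z v a b k \<le> ?W"
        using k'(1) unfolding is_arg_max_def by (simp add: le_max_iff_disj not_less)
      then show ?thesis using f by (intro mult_left_mono) (auto simp: feasible_forwarding_def)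
    next
      case False
      then show ?thesis using f by (simp add: feasible_forwarding_def)
    qed
  qed
  also have "\<dots> = (\<Sum>k\<in>UNIV. \<mu>' a b k) * ?W" by (simp add: sum_distrib_right)
  also have "\<dots> \<le> cap G b a / obj_size G * ?W"
    by (intro mult_right_mono feasible_forwarding_le[OF G f]) auto
  also have "\<dots> = (\<Sum>k\<in>UNIV. \<mu> a b k * efc_weight \<eta> z v a b k)"
  proof -
    have "(\<Sum>k\<in>UNIV. \<mu> a b k * efc_weight \<eta> z v a b k) =
       (\<Sum>k\<in>UNIV. if k = k' then cap G b a / obj_size G * ?W else 0)"
      by (intro sum.cong) (auto simp: k'(2))
    then show ?thesis by simp
  qed
  finally show ?thesis .
next
  case False
  then have "\<mu> a b k = 0" "\<mu>' a b k = 0" for k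
    using e f unfolding efc_forwarding_def feasible_forwarding_def by meson+
  then show ?thesis by simp
qed

text \<open>Summation by parts on the graph: it turns an objective stated per node into one stated
  per link, where the weight differences are the \<open>efc_weight\<close> values that the algorithm
  maximizes.\<close>

lemma sum_net_outflow:
  fixes w :: "'n::finite \<Rightarrow> 'k::finite \<Rightarrow> real"
  shows "(\<Sum>n\<in>UNIV. \<Sum>k\<in>UNIV. w n k * ((\<Sum>b\<in>UNIV. \<mu> n b k) - (\<Sum>a\<in>UNIV. \<mu> a n k)))
    = (\<Sum>a\<in>UNIV. \<Sum>b\<in>UNIV. \<Sum>k\<in>UNIV. \<mu> a b k * (w a k - w b k))"
proof -
  have o: "(\<Sum>n\<in>UNIV. \<Sum>k\<in>UNIV. \<Sum>b\<in>UNIV. w n k * \<mu> n b k) = (\<Sum>a\<in>UNIV. \<Sum>b\<in>UNIV. \<Sum>k\<in>UNIV. \<mu> a b k * w a k)"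
    by (rule sum.cong[OF refl], subst sum.swap) (simp add: mult.commute)
  have "(\<Sum>n\<in>UNIV. \<Sum>k\<in>UNIV. \<Sum>a\<in>UNIV. w n k * \<mu> a n k) = (\<Sum>n\<in>UNIV. \<Sum>a\<in>UNIV. \<Sum>k\<in>UNIV. \<mu> a n k * w n k)"
    by (rule sum.cong[OF refl], subst sum.swap) (simp add: mult.commute)
  also have "\<dots> = (\<Sum>a\<in>UNIV. \<Sum>b\<in>UNIV. \<Sum>k\<in>UNIV. \<mu> a b k * w b k)"
    by (rule sum.swap)
  finally show ?thesis
    using o by (simp add: right_diff_distrib sum_subtractf sum_distrib_left)
qed

lemma efc_caching_optimal:
  assumes "efc_caching G \<eta> z v s" "feasible_caching_at G n x"
  shows "(\<Sum>k\<in>UNIV. (v $ n $ k + bias \<eta> z v n k) * x k) \<le> (\<Sum>k\<in>UNIV. (v $ n $ k + bias \<eta> z v n k) * s n k)"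
  using assms unfolding efc_caching_def is_arg_max_def by (meson not_less)

lemma divide_ereal_real:
  "0 < z \<Longrightarrow> real_of_ereal (ereal x / z) = x * real_of_ereal (1 / z)"
  by (cases z) (auto simp: one_ereal_def)

text \<open>Replacing all weights \<open>\<eta>\<close> by 1 gives an upper bound that is the same
  at every node. The biases for one object therefore lie in a common interval, and their differences
  across links are bounded by its length.\<close>

lemma bias_bounds:
  assumes \<eta>: "\<And>n n' k v. \<eta> n n' k v \<in> {0..1}" and z: "\<And>n k. 0 < z n k" and v: "\<And>n k. 0 \<le> v $ n $ k"
  shows "0 \<le> bias \<eta> z v n k" "bias \<eta> z v n k \<le> (\<Sum>n'\<in>UNIV. v $ n' $ k * real_of_ereal (1 / z n' k))"
proof -
  have "0 \<le> real_of_ereal (1 / z n k)" for n k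
    using z[of n k] by (cases "z n k") (auto simp: one_ereal_def)
  then have "0 \<le> \<eta> n n' k v * (v $ n' $ k * real_of_ereal (1 / z n' k))"
    "\<eta> n n' k v * (v $ n' $ k * real_of_ereal (1 / z n' k)) \<le> 1 * (v $ n' $ k * real_of_ereal (1 / z n' k))" for n'
    using \<eta>[of n n' k v] v[of n' k] by (intro mult_nonneg_nonneg mult_right_mono; simp)+
  then show "0 \<le> bias \<eta> z v n k" "bias \<eta> z v n k \<le> (\<Sum>n'\<in>UNIV. v $ n' $ k * real_of_ereal (1 / z n' k))"
    unfolding bias_def divide_ereal_real[OF z] by (auto intro!: sum_nonneg sum_mono)
qed

text \<open>Only links allowed for \<open>k\<close> contribute. Each carries at most
  \<open>C_max\<close>, since its reverse is also a link and provides the capacity, and two values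
  in \<open>[0, S]\<close> differ by at most \<open>S\<close>.\<close>

lemma bias_net_outflow_bound:
  fixes G :: "('n::finite, 'k::finite) vip_network" and f :: "'n \<Rightarrow> real"
  assumes G: "vip_network G" and \<mu>: "feasible_forwarding G \<mu>"
    and f: "\<And>n. 0 \<le> f n" "\<And>n. f n \<le> S"
  shows "\<bar>\<Sum>a\<in>UNIV. \<Sum>b\<in>UNIV. \<mu> a b k * (f a - f b)\<bar> \<le> C_max G * real (card (obj_links G k)) * S"
proof -
  have nonneg: "0 \<le> \<mu> a b k" for a b k using \<mu> by (simp add: feasible_forwarding_def)
  have S: "0 \<le> S" using f[of undefined] by linarith
  have *: "\<bar>\<mu> a b k * (f a - f b)\<bar> \<le> (if (a, b) \<in> obj_links G k then C_max G * S else 0)" for a b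
  proof (cases "(a, b) \<in> obj_links G k")
    case True
    then have l: "(b, a) \<in> links G" using G unfolding vip_network_def by (meson subsetD)
    have "\<mu> a b k \<le> (\<Sum>k\<in>UNIV. \<mu> a b k)" by (intro member_le_sum nonneg) auto
    also have "\<dots> \<le> C_max G"
      using feasible_forwarding_le[OF G \<mu>, of a b] cap_le_C_max[OF G l] by linarith
    finally have "\<mu> a b k * \<bar>f a - f b\<bar> \<le> C_max G * S"
      using f[of a] f[of b] nonneg[of a b k] S by (intro mult_mono) auto
    then show ?thesis using True nonneg[of a b k] by (simp add: abs_mult)
  next
    case False
    then show ?thesis using \<mu> by (simp add: feasible_forwarding_def)
  qed
  have "\<bar>\<Sum>a\<in>UNIV. \<Sum>b\<in>UNIV. \<mu> a b k * (f a - f b)\<bar> \<le> (\<Sum>a\<in>UNIV. \<Sum>b\<in>UNIV. \<bar>\<mu> a b k * (f a - f b)\<bar>)"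
    by (rule order_trans[OF sum_abs]) (intro sum_mono sum_abs)
  also have "\<dots> \<le> (\<Sum>a\<in>UNIV. \<Sum>b\<in>UNIV. if (a, b) \<in> obj_links G k then C_max G * S else 0)"
    by (intro sum_mono *)
  also have "\<dots> = (\<Sum>p\<in>UNIV. if p \<in> obj_links G k then C_max G * S else 0)"
    by (simp add: sum.cartesian_product)
  also have "\<dots> = C_max G * real (card (obj_links G k)) * S"
    by (subst sum.If_cases) auto
  finally show ?thesis .
qed

lemma cache_rate_le_r_max: "cache_rate G n \<le> r_max G"
  unfolding r_max_def by (rule Max_ge) auto

text \<open>
  The flow part of \<open>eps_z\<close> has a factor 2 because the bias perturbs the objective of both
  compared forwarding actions. The caching part has none: the bias is nonnegative, so the term of
  the competing caching action has the favourable sign and is dropped.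
\<close>

lemma efc_near_optimal:
  fixes G :: "('n::finite, 'k::finite) vip_network"
  assumes G: "vip_network G"
    and \<eta>: "\<And>n n' k v. \<eta> n n' k v \<in> {0..1}" and z: "\<And>n k. 0 < z n k" and v: "\<And>n k. 0 \<le> v $ n $ k"
    and efc: "efc_forwarding G \<eta> z v \<mu>" "efc_caching G \<eta> z v s"
    and feas: "feasible_forwarding G \<mu>'" "\<And>n. feasible_caching_at G n (s' n)"
  shows "(\<Sum>n\<in>UNIV. \<Sum>k\<in>UNIV. v $ n $ k * net_service G \<mu>' s' n k)
    \<le> (\<Sum>n\<in>UNIV. \<Sum>k\<in>UNIV. v $ n $ k * net_service G \<mu> s n k) + (\<Sum>n\<in>UNIV. \<Sum>k\<in>UNIV. v $ n $ k * eps_z G z $ n $ k)"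
proof -
  have r: "0 \<le> cache_rate G n" for n using G by (simp add: vip_network_def)
  define f where "f = bias \<eta> z v"
  define S where "S k = (\<Sum>n\<in>UNIV. v $ n $ k * real_of_ereal (1 / z n k))" for k
  define w where "w n k = v $ n $ k + f n k" for n k
  have f: "0 \<le> f n k" "f n k \<le> S k" for n k
    unfolding f_def S_def using bias_bounds[OF \<eta> z v] by auto
  have split: "(\<Sum>n\<in>UNIV. \<Sum>k\<in>UNIV. x n k * net_service G m c n k) =
      (\<Sum>a\<in>UNIV. \<Sum>b\<in>UNIV. \<Sum>k\<in>UNIV. m a b k * (x a k - x b k))
      + (\<Sum>n\<in>UNIV. \<Sum>k\<in>UNIV. x n k * (cache_rate G n * c n k))" for x :: "'n \<Rightarrow> 'k \<Rightarrow> real" and m c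
    unfolding sum_net_outflow[symmetric] by (simp add: distrib_left sum.distrib)
  have s: "0 \<le> s n k" "s n k \<le> 1" for n k
    using efc(2) unfolding efc_caching_def is_arg_max_def feasible_caching_at_def
    by (metis insertE less_eq_real_def singletonD zero_le_one order_refl)+
  have s': "0 \<le> s' n k" for n k
    using feas(2)[of n] unfolding feasible_caching_at_def by (metis insertE singletonD zero_le_one order_refl)
  \<comment> \<open>For the biased lengths \<open>w\<close> the algorithm is exactly optimal; all
    loss comes from replacing \<open>w\<close> by \<open>v\<close> afterwards.\<close>
  have opt: "(\<Sum>n\<in>UNIV. \<Sum>k\<in>UNIV. w n k * net_service G \<mu>' s' n k) \<le> (\<Sum>n\<in>UNIV. \<Sum>k\<in>UNIV. w n k * net_service G \<mu> s n k)"
    unfolding split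
  proof (rule add_mono[OF sum_mono[OF sum_mono] sum_mono])
    show "(\<Sum>k\<in>UNIV. \<mu>' a b k * (w a k - w b k)) \<le> (\<Sum>k\<in>UNIV. \<mu> a b k * (w a k - w b k))" for a b
      using efc_forwarding_optimal[OF G efc(1) feas(1)] by (simp add: efc_weight_def w_def f_def)
    have "cache_rate G n * (\<Sum>k\<in>UNIV. w n k * s' n k) \<le> cache_rate G n * (\<Sum>k\<in>UNIV. w n k * s n k)" for n
      using efc_caching_optimal[OF efc(2) feas(2)] by (intro mult_left_mono r) (simp add: w_def f_def)
    then show "(\<Sum>k\<in>UNIV. w n k * (cache_rate G n * s' n k)) \<le> (\<Sum>k\<in>UNIV. w n k * (cache_rate G n * s n k))" for n
      by (simp add: sum_distrib_left mult_ac)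
  qed
  have flow: "\<bar>\<Sum>a\<in>UNIV. \<Sum>b\<in>UNIV. \<Sum>k\<in>UNIV. m a b k * (f a k - f b k)\<bar>
      \<le> (\<Sum>k\<in>UNIV. C_max G * real (card (obj_links G k)) * S k)" if m: "feasible_forwarding G m" for m
  proof -
    have "(\<Sum>a\<in>UNIV. \<Sum>b\<in>UNIV. \<Sum>k\<in>UNIV. m a b k * (f a k - f b k)) = (\<Sum>a\<in>UNIV. \<Sum>k\<in>UNIV. \<Sum>b\<in>UNIV. m a b k * (f a k - f b k))"
      by (rule sum.cong[OF refl], rule sum.swap)
    also have "\<dots> = (\<Sum>k\<in>UNIV. \<Sum>a\<in>UNIV. \<Sum>b\<in>UNIV. m a b k * (f a k - f b k))"
      by (rule sum.swap)
    finally show ?thesis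
      by (simp only:) (rule order_trans[OF sum_abs], intro sum_mono bias_net_outflow_bound[OF G m] f)
  qed
  have "(\<Sum>n\<in>UNIV. \<Sum>k\<in>UNIV. f n k * (cache_rate G n * s n k)) \<le> (\<Sum>n\<in>(UNIV::'n set). \<Sum>k\<in>UNIV. S k * (r_max G * 1))"
  proof (intro sum_mono)
    fix n k
    have "0 \<le> S k" using f[of n k] by linarith
    moreover have "0 \<le> r_max G" using r[of n] cache_rate_le_r_max[of G n] by linarith
    ultimately show "f n k * (cache_rate G n * s n k) \<le> S k * (r_max G * 1)"
      by (intro mult_mono f s r cache_rate_le_r_max mult_nonneg_nonneg)
  qed
  then have cache: "(\<Sum>n\<in>UNIV. \<Sum>k\<in>UNIV. f n k * (cache_rate G n * s n k)) \<le> (\<Sum>k\<in>UNIV. real CARD('n) * r_max G * S k)"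
    by (simp add: sum_distrib_left mult_ac)
  have cache': "0 \<le> (\<Sum>n\<in>UNIV. \<Sum>k\<in>UNIV. f n k * (cache_rate G n * s' n k))"
    by (intro sum_nonneg mult_nonneg_nonneg f r s')
  \<comment> \<open>The origin of \<open>eps_z\<close>: \<open>S k\<close> is a sum over nodes of
    \<open>v $ n $ k / z n k\<close>, so an error proportional to \<open>S k\<close> can be
    redistributed as a penalty on each queue. The factor \<open>CARD('n)\<close> arises because the
    cache of every node contributes an error of up to \<open>r_max G * S k\<close>.\<close>
  have eps: "(\<Sum>n\<in>UNIV. \<Sum>k\<in>UNIV. v $ n $ k * eps_z G z $ n $ k) =
      2 * (\<Sum>k\<in>UNIV. C_max G * real (card (obj_links G k)) * S k) + (\<Sum>k\<in>UNIV. real CARD('n) * r_max G * S k)"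
  proof -
    have "(\<Sum>n\<in>UNIV. \<Sum>k\<in>UNIV. v $ n $ k * eps_z G z $ n $ k) = (\<Sum>k\<in>UNIV. \<Sum>n\<in>UNIV. v $ n $ k * eps_z G z $ n $ k)"
      by (rule sum.swap)
    also have "\<dots> = (\<Sum>k\<in>UNIV. (2 * C_max G * real (card (obj_links G k)) + real CARD('n) * r_max G) * S k)"
      unfolding S_def sum_distrib_left
      by (intro sum.cong refl) (simp add: eps_z_def divide_ereal_real[OF z] mult_ac)
    also have "\<dots> = 2 * (\<Sum>k\<in>UNIV. C_max G * real (card (obj_links G k)) * S k) + (\<Sum>k\<in>UNIV. real CARD('n) * r_max G * S k)"
      unfolding sum_distrib_left sum.distrib[symmetric] by (intro sum.cong refl) (simp add: algebra_simps)
    finally show ?thesis .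
  qed
  have w: "(\<Sum>n\<in>UNIV. \<Sum>k\<in>UNIV. w n k * net_service G m c n k) = (\<Sum>n\<in>UNIV. \<Sum>k\<in>UNIV. v $ n $ k * net_service G m c n k)
     + (\<Sum>n\<in>UNIV. \<Sum>k\<in>UNIV. f n k * net_service G m c n k)" for m c
    unfolding w_def distrib_right[of "_ $ _"] by (simp only: sum.distrib)
  show ?thesis
    using opt flow[OF feas(1)] flow[OF efc_forwarding_feasible[OF G efc(1)]] cache cache'
    unfolding w eps split[of f] by linarith
qed

text \<open>The vector \<open>v\<close> stays fixed while the competing action runs through the list
  from \<open>stability_region_service\<close>; averaging the near-optimality bounds gives the claim
  up to \<open>\<xi> * S\<close>, and \<open>\<xi>\<close> is arbitrary. Sources, where the list
  guarantees nothing, have weight zero.\<close>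

lemma efc_serves_stability_region:
  fixes G :: "('n::finite, 'k::finite) vip_network"
  assumes G: "vip_network G"
    and \<eta>: "\<And>n n' k v. \<eta> n n' k v \<in> {0..1}" and z: "\<And>n k. 0 < z n k"
    and v: "\<And>n k. 0 \<le> v $ n $ k" "\<And>k. v $ src G k $ k = 0"
    and efc: "efc_forwarding G \<eta> z v \<mu>" "efc_caching G \<eta> z v s"
    and lam: "lam \<in> stability_region G"
  shows "(\<Sum>n\<in>UNIV. \<Sum>k\<in>UNIV. v $ n $ k * lam $ n $ k)
    \<le> (\<Sum>n\<in>UNIV. \<Sum>k\<in>UNIV. v $ n $ k * net_service G \<mu> s n k) + (\<Sum>n\<in>UNIV. \<Sum>k\<in>UNIV. v $ n $ k * eps_z G z $ n $ k)"
    (is "?L \<le> ?R")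
proof -
  define S where "S = (\<Sum>n\<in>UNIV. \<Sum>k\<in>UNIV. v $ n $ k)"
  have S: "0 \<le> S" unfolding S_def by (intro sum_nonneg v)
  have *: "?L - \<xi> * S \<le> ?R" if \<xi>: "0 < \<xi>" for \<xi>
  proof -
    obtain T :: nat and \<mu>' s' where T: "0 < T"
      and feas: "\<And>\<tau>. feasible_forwarding G (\<mu>' \<tau>)" "\<And>\<tau> n. feasible_caching_at G n (s' \<tau> n)"
      and serv: "\<And>n k. n \<noteq> src G k \<Longrightarrow> real T * (lam $ n $ k - \<xi>) \<le> (\<Sum>\<tau>\<in>{1..T}. net_service G (\<mu>' \<tau>) (s' \<tau>) n k)"
      by (rule stability_region_service[OF lam \<xi>]) blast
    have "real T * (?L - \<xi> * S) = (\<Sum>n\<in>UNIV. \<Sum>k\<in>UNIV. v $ n $ k * (real T * (lam $ n $ k - \<xi>)))"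
      by (simp add: S_def sum_distrib_left sum_subtractf[symmetric] right_diff_distrib mult_ac)
    also have "\<dots> \<le> (\<Sum>n\<in>UNIV. \<Sum>k\<in>UNIV. v $ n $ k * (\<Sum>\<tau>\<in>{1..T}. net_service G (\<mu>' \<tau>) (s' \<tau>) n k))"
    proof (intro sum_mono)
      fix n k
      show "v $ n $ k * (real T * (lam $ n $ k - \<xi>)) \<le> v $ n $ k * (\<Sum>\<tau>\<in>{1..T}. net_service G (\<mu>' \<tau>) (s' \<tau>) n k)"
        using v serv[of n k] by (cases "n = src G k") (auto intro!: mult_left_mono)
    qed
    also have "\<dots> = (\<Sum>\<tau>\<in>{1..T}. \<Sum>n\<in>UNIV. \<Sum>k\<in>UNIV. v $ n $ k * net_service G (\<mu>' \<tau>) (s' \<tau>) n k)"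
      unfolding sum_distrib_left by (subst sum.swap, subst sum.swap[of _ _ UNIV]) simp
    also have "\<dots> \<le> (\<Sum>\<tau>\<in>{1..T}. ?R)"
      by (intro sum_mono efc_near_optimal[OF G \<eta> z v(1) efc feas])
    finally have "real T * (?L - \<xi> * S) \<le> real T * ?R" by simp
    then show ?thesis using T by simp
  qed
  show ?thesis
  proof (rule field_le_epsilon)
    fix e :: real assume e: "0 < e"
    \<comment> \<open>Dividing by \<open>S + 1\<close> rather than \<open>S\<close> covers the case
      of empty queues.\<close>
    have "e / (S + 1) * S \<le> e" using S e by (simp add: field_simps)
    then show "?L \<le> ?R + e" using *[of "e / (S + 1)"] S e by simp
  qed
qed

section \<open>Lyapunov drift\<close>

text \<open>
  The linear term \<open>- 2 * m * V\<close> cancels the product of arrivals and inflow, and does so even if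
  the dynamics discard packets: discarding \<open>d\<close> changes the bound by \<open>2 * m * d - d\<^sup>2 \<le> m\<^sup>2\<close>.
\<close>

lemma queue_step:
  fixes V V' a i c m o' :: real
  assumes "0 \<le> V" "0 \<le> V'" "0 \<le> a" "0 \<le> i" "0 \<le> c" "0 \<le> m" "0 \<le> o'"
    and "V' \<le> max 0 (max 0 (V - o') + a + i - c)"
  shows "V'\<^sup>2 - 2 * m * V' \<le> V\<^sup>2 - 2 * m * V + 2 * V * (i - o' - c) + a * (2 * V + 2 * i - 2 * c - 2 * m)
     + a\<^sup>2 + o'\<^sup>2 + 2 * o' * c + (i - c)\<^sup>2 + 2 * m * (o' + c - i) + m\<^sup>2"
proof -
  define X where "X = max 0 (V - o') + a + i - c"
  define d where "d = max 0 X - V'"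
  have d: "0 \<le> d" using assms by (simp add: d_def X_def)
  have V': "V' = max 0 X - d" by (simp add: d_def)
  \<comment> \<open>Discarding \<open>d\<close> lowers the square by at least
    \<open>d\<^sup>2\<close> because the remaining queue is nonnegative. This gain is kept, as it
    later pays for \<open>2 * m * d\<close>.\<close>
  have "V'\<^sup>2 + d\<^sup>2 + 2 * V' * d = (max 0 X)\<^sup>2"
    by (simp add: V' power2_eq_square algebra_simps)
  moreover have "(max 0 X)\<^sup>2 \<le> X\<^sup>2" by (simp add: max_def)
  moreover have "0 \<le> V' * d" using assms d by simp
  ultimately have 1: "V'\<^sup>2 \<le> X\<^sup>2 - d\<^sup>2" by linarith
  have "X \<le> V' + d" by (simp add: d_def)
  moreover have "V - o' + a + i - c \<le> X" by (simp add: X_def)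
  ultimately have "V - o' + a + i - c - d \<le> V'" by linarith
  then have 2: "2 * m * (V - o' + a + i - c - d) \<le> 2 * m * V'"
    using assms by (intro mult_left_mono) auto
  have 3: "2 * m * d - d\<^sup>2 \<le> m\<^sup>2"
    using zero_le_power2[of "m - d"] by (simp add: power2_eq_square algebra_simps)
  have "(max 0 (V - o'))\<^sup>2 \<le> (V - o')\<^sup>2" by (simp add: max_def)
  moreover have "max 0 (V - o') * (a + i) \<le> V * (a + i)"
    using assms by (intro mult_right_mono) auto
  \<comment> \<open>The caching term enters with a negative sign, so here the positive part is
    bounded from below; expanding \<open>- 2 * (V - o') * c\<close> is what produces the term
    \<open>2 * o' * c\<close>.\<close>
  moreover have "(V - o') * c \<le> max 0 (V - o') * c"
    using assms by (intro mult_right_mono) auto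
  moreover have "X\<^sup>2 = (max 0 (V - o'))\<^sup>2 + 2 * (max 0 (V - o') * (a + i)) - 2 * (max 0 (V - o') * c)
      + (a + i - c)\<^sup>2"
    by (simp add: X_def power2_eq_square algebra_simps)
  ultimately have "X\<^sup>2 \<le> (V - o')\<^sup>2 + 2 * (V * (a + i)) - 2 * ((V - o') * c) + (a + i - c)\<^sup>2"
    by linarith
  with 1 2 3 show ?thesis
    by (simp add: power2_eq_square algebra_simps)
qed

lemma sum_squares_le_square_sum:
  fixes f :: "'a \<Rightarrow> real"
  assumes "finite I" "\<And>i. i \<in> I \<Longrightarrow> 0 \<le> f i"
  shows "(\<Sum>i\<in>I. (f i)\<^sup>2) \<le> (\<Sum>i\<in>I. f i)\<^sup>2"
proof -
  have "(\<Sum>i\<in>I. (f i)\<^sup>2) \<le> (\<Sum>i\<in>I. f i * (\<Sum>i\<in>I. f i))"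
    unfolding power2_eq_square
    by (intro sum_mono mult_left_mono member_le_sum assms) auto
  then show ?thesis by (simp add: sum_distrib_right power2_eq_square)
qed

text \<open>Let \<open>P\<close> and \<open>Q\<close> bound outflow and inflow, \<open>A\<close> be
  the total arrival bound and \<open>K * r\<close> the caching bound. The terms on the left are at
  most \<open>A\<^sup>2\<close>, \<open>P\<^sup>2\<close>, \<open>(K * r)\<^sup>2\<close>,
  \<open>2 * A * P\<close> and \<open>2 * P * K * r\<close>, all found in the expansion of
  \<open>(A + P + K * r)\<^sup>2\<close>, and \<open>Q\<^sup>2\<close>, the first summand of
  \<open>B\<close>. A product of arrivals and inflow would not fit here.\<close>

lemma second_order_bound:
  fixes G :: "('n::finite, 'k::finite) vip_network"
  assumes G: "vip_network G" and \<mu>: "feasible_forwarding G \<mu>"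
    and s: "\<And>n k. 0 \<le> s n k" "\<And>n k. s n k \<le> 1"
    and m: "\<And>n k. 0 \<le> m n k" "\<And>n k. m n k \<le> A_max $ n $ k"
  shows "(\<Sum>n\<in>UNIV. \<Sum>k\<in>UNIV. (A_max $ n $ k)\<^sup>2 + ((\<Sum>b\<in>UNIV. \<mu> n b k)\<^sup>2
     + 2 * (\<Sum>b\<in>UNIV. \<mu> n b k) * (cache_rate G n * s n k)
     + ((\<Sum>a\<in>UNIV. \<mu> a n k) - cache_rate G n * s n k)\<^sup>2 + 2 * m n k * (\<Sum>b\<in>UNIV. \<mu> n b k)))
    \<le> 2 * (real CARD('n) * bound_B G A_max)"
proof -
  have "2 * (real CARD('n) * bound_B G A_max) = (\<Sum>n\<in>UNIV. (mu_out_max G n)\<^sup>2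
        + ((\<Sum>k\<in>UNIV. A_max $ n $ k) + mu_in_max G n + real CARD('k) * cache_rate G n)\<^sup>2
        + 2 * mu_out_max G n * real CARD('k) * cache_rate G n)"
    by (simp add: bound_B_def)
  moreover have "(\<Sum>k\<in>UNIV. (A_max $ n $ k)\<^sup>2 + ((\<Sum>b\<in>UNIV. \<mu> n b k)\<^sup>2
     + 2 * (\<Sum>b\<in>UNIV. \<mu> n b k) * (cache_rate G n * s n k)
     + ((\<Sum>a\<in>UNIV. \<mu> a n k) - cache_rate G n * s n k)\<^sup>2 + 2 * m n k * (\<Sum>b\<in>UNIV. \<mu> n b k)))
     \<le> (mu_out_max G n)\<^sup>2
        + ((\<Sum>k\<in>UNIV. A_max $ n $ k) + mu_in_max G n + real CARD('k) * cache_rate G n)\<^sup>2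
        + 2 * mu_out_max G n * real CARD('k) * cache_rate G n" for n
  proof -
    define r where "r = cache_rate G n"
    define K where "K = real CARD('k)"
    define P where "P = mu_in_max G n"
    define Q where "Q = mu_out_max G n"
    define Am where "Am k = A_max $ n $ k" for k
    define A where "A = (\<Sum>k\<in>UNIV. Am k)"
    define out where "out k = (\<Sum>b\<in>UNIV. \<mu> n b k)" for k
    define inn where "inn k = (\<Sum>a\<in>UNIV. \<mu> a n k)" for k
    define c where "c k = cache_rate G n * s n k" for k
    have r: "0 \<le> r" using G by (simp add: r_def vip_network_def)
    have K: "1 \<le> K" unfolding K_def
      by (metis One_nat_def Suc_leI of_nat_1 of_nat_le_iff zero_less_card_finite)
    have "0 \<le> \<mu> a b k" for a b k using \<mu> by (simp add: feasible_forwarding_def)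
    then have out: "0 \<le> out k" and inn: "0 \<le> inn k" for k
      by (auto simp: out_def inn_def intro!: sum_nonneg)
    have Am: "0 \<le> Am k" for k using m[of n k] by (simp add: Am_def)
    have c: "0 \<le> c k" "c k \<le> r" for k
      using s[of n k] r by (auto simp: c_def r_def mult_left_le)
    have sout: "(\<Sum>k\<in>UNIV. out k) \<le> P" and sinn: "(\<Sum>k\<in>UNIV. inn k) \<le> Q"
      using feasible_forwarding_out_le[OF G \<mu>] feasible_forwarding_in_le[OF G \<mu>]
      by (auto simp: out_def inn_def P_def Q_def)
    have PQ: "0 \<le> P" "0 \<le> Q" 
      using sout sinn sum_nonneg[of UNIV out] sum_nonneg[of UNIV inn] out inn
      by (auto intro: order_trans)
    have A: "0 \<le> A" unfolding A_def by (intro sum_nonneg Am)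
    have 1: "(\<Sum>k\<in>UNIV. (Am k)\<^sup>2) \<le> A\<^sup>2"
      unfolding A_def by (intro sum_squares_le_square_sum Am) auto
    have "(\<Sum>k\<in>UNIV. (out k)\<^sup>2) \<le> (\<Sum>k\<in>UNIV. out k)\<^sup>2"
      by (intro sum_squares_le_square_sum out) auto
    also have "\<dots> \<le> P\<^sup>2" by (intro power_mono sout sum_nonneg out)
    finally have 2: "(\<Sum>k\<in>UNIV. (out k)\<^sup>2) \<le> P\<^sup>2" .
    have "(\<Sum>k\<in>UNIV. (inn k)\<^sup>2) \<le> (\<Sum>k\<in>UNIV. inn k)\<^sup>2"
      by (intro sum_squares_le_square_sum inn) auto
    also have "\<dots> \<le> Q\<^sup>2" by (intro power_mono sinn sum_nonneg inn)
    finally have 3: "(\<Sum>k\<in>UNIV. (inn k)\<^sup>2) \<le> Q\<^sup>2" .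
    have "(\<Sum>k\<in>UNIV. (c k)\<^sup>2) \<le> (\<Sum>k\<in>(UNIV::'k set). r\<^sup>2)"
      by (intro sum_mono power_mono c)
    also have "\<dots> = K * r\<^sup>2" by (simp add: K_def)
    also have "\<dots> \<le> (K * K) * r\<^sup>2" using K by (intro mult_right_mono) auto
    finally have 4: "(\<Sum>k\<in>UNIV. (c k)\<^sup>2) \<le> (K * r)\<^sup>2" by (simp add: power2_eq_square mult_ac)
    have "(\<Sum>k\<in>UNIV. out k * c k) \<le> (\<Sum>k\<in>UNIV. out k * r)"
      by (intro sum_mono mult_left_mono c out)
    also have "\<dots> = (\<Sum>k\<in>UNIV. out k) * r" by (simp add: sum_distrib_right)
    also have "\<dots> \<le> P * r" by (intro mult_right_mono sout r)
    also have "\<dots> \<le> P * (K * r)" using K r PQ by (intro mult_left_mono) (auto simp: mult_le_cancel_right1)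
    finally have 5: "(\<Sum>k\<in>UNIV. out k * c k) \<le> P * (K * r)" .
    have "m n k \<le> A" for k
      using m(2)[of n k] member_le_sum[of k UNIV Am] Am by (auto simp: A_def Am_def)
    then have "(\<Sum>k\<in>UNIV. m n k * out k) \<le> (\<Sum>k\<in>UNIV. A * out k)"
      by (intro sum_mono mult_right_mono out)
    also have "\<dots> = A * (\<Sum>k\<in>UNIV. out k)" by (simp add: sum_distrib_left)
    also have "\<dots> \<le> A * P" by (intro mult_left_mono sout A)
    finally have 6: "(\<Sum>k\<in>UNIV. m n k * out k) \<le> A * P" .
    have "(inn k - c k)\<^sup>2 \<le> (inn k)\<^sup>2 + (c k)\<^sup>2" for k
      using mult_nonneg_nonneg[OF inn[of k] c(1)[of k]] by (simp add: power2_eq_square algebra_simps)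
    then have "(\<Sum>k\<in>UNIV. (Am k)\<^sup>2 + ((out k)\<^sup>2 + 2 * out k * c k + (inn k - c k)\<^sup>2 + 2 * m n k * out k))
        \<le> (\<Sum>k\<in>UNIV. (Am k)\<^sup>2 + ((out k)\<^sup>2 + 2 * (out k * c k) + ((inn k)\<^sup>2 + (c k)\<^sup>2) + 2 * (m n k * out k)))"
      by (intro sum_mono) (auto simp: algebra_simps)
    also have "\<dots> = (\<Sum>k\<in>UNIV. (Am k)\<^sup>2) + ((\<Sum>k\<in>UNIV. (out k)\<^sup>2) + 2 * (\<Sum>k\<in>UNIV. out k * c k)
        + ((\<Sum>k\<in>UNIV. (inn k)\<^sup>2) + (\<Sum>k\<in>UNIV. (c k)\<^sup>2)) + 2 * (\<Sum>k\<in>UNIV. m n k * out k))"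
      by (simp add: sum.distrib sum_distrib_left)
    also have "\<dots> \<le> A\<^sup>2 + (P\<^sup>2 + 2 * (P * (K * r)) + (Q\<^sup>2 + (K * r)\<^sup>2) + 2 * (A * P))"
      using 1 2 3 4 5 6 by linarith
    also have "\<dots> \<le> Q\<^sup>2 + (A + P + K * r)\<^sup>2 + 2 * Q * K * r"
    proof -
      have "0 \<le> A * (K * r)" "0 \<le> Q * (K * r)" using A PQ K r by auto
      then show ?thesis by (simp add: power2_eq_square algebra_simps)
    qed
    finally show ?thesis
      by (simp add: r_def K_def P_def Q_def Am_def A_def out_def inn_def c_def)
  qed
  ultimately show ?thesis by (simp add: sum_mono)
qed

section \<open>Bounded random variables and independence\<close>

text \<open>Unlike integrability, boundedness is preserved by products, so the integrability of
  every polynomial in queues, arrivals and actions follows from closure rules. The measure argument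
  also serves to express measurability with respect to a sub-sigma-algebra.\<close>

definition bounded_rv :: "'w measure \<Rightarrow> ('w \<Rightarrow> real) \<Rightarrow> bool" where
  "bounded_rv M f \<longleftrightarrow> f \<in> borel_measurable M \<and> (\<exists>B. \<forall>x\<in>space M. \<bar>f x\<bar> \<le> B)"

lemma bounded_rv_measurable: "bounded_rv M f \<Longrightarrow> f \<in> borel_measurable M"
  by (simp add: bounded_rv_def)

lemma bounded_rv_const: "bounded_rv M (\<lambda>_. c)"
  by (auto simp: bounded_rv_def)

lemma bounded_rv_add: "bounded_rv M f \<Longrightarrow> bounded_rv M g \<Longrightarrow> bounded_rv M (\<lambda>x. f x + g x)"
  unfolding bounded_rv_def
  by (auto intro!: borel_measurable_add) (meson abs_triangle_ineq add_mono order_trans)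

lemma bounded_rv_mult: "bounded_rv M f \<Longrightarrow> bounded_rv M g \<Longrightarrow> bounded_rv M (\<lambda>x. f x * g x)"
  unfolding bounded_rv_def abs_mult
  by (auto intro!: borel_measurable_times) (meson abs_ge_zero mult_mono order_trans)

lemma bounded_rv_diff: "bounded_rv M f \<Longrightarrow> bounded_rv M g \<Longrightarrow> bounded_rv M (\<lambda>x. f x - g x)"
  using bounded_rv_add[of M f "\<lambda>x. - 1 * g x"] bounded_rv_mult[OF bounded_rv_const, of M g "- 1"] by simp

lemma bounded_rv_power2: "bounded_rv M f \<Longrightarrow> bounded_rv M (\<lambda>x. (f x)\<^sup>2)"
  unfolding power2_eq_square by (rule bounded_rv_mult)

lemma bounded_rv_sum: "(\<And>i. i \<in> I \<Longrightarrow> bounded_rv M (f i)) \<Longrightarrow> bounded_rv M (\<lambda>x. \<Sum>i\<in>I. f i x)"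
  by (induction I rule: infinite_finite_induct) (auto intro: bounded_rv_const bounded_rv_add)

lemmas bounded_rv_intros = bounded_rv_const bounded_rv_add bounded_rv_mult bounded_rv_diff
  bounded_rv_power2 bounded_rv_sum

lemma bounded_rv_subalgebra: "subalgebra M N \<Longrightarrow> bounded_rv N f \<Longrightarrow> bounded_rv M f"
  unfolding bounded_rv_def subalgebra_def
  by (metis measurable_from_subalg subalgebra_def)

lemma (in finite_measure) bounded_rv_integrable: "bounded_rv M f \<Longrightarrow> integrable M f"
  unfolding bounded_rv_def by (auto intro!: integrable_const_bound AE_I2)

text \<open>The sigma-algebra of \<open>f (Y \<omega>)\<close> lies in that of \<open>Y\<close> and
  the one of \<open>g\<close> lies in \<open>F\<close>, so independence is inherited. It is applied
  to one coordinate of the arrivals in a slot and a quantity known at the beginning of that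
  slot.\<close>

lemma (in prob_space) expectation_mult_indep_subalgebra:
  fixes f :: "'b::topological_space \<Rightarrow> real"
  assumes F: "subalgebra M F"
    and ind: "indep_set (sets (vimage_algebra (space M) Y borel)) (sets F)"
    and f: "f \<in> borel_measurable borel" "bounded_rv M (\<lambda>\<omega>. f (Y \<omega>))" and g: "bounded_rv F g"
  shows "expectation (\<lambda>\<omega>. f (Y \<omega>) * g \<omega>) = expectation (\<lambda>\<omega>. f (Y \<omega>)) * expectation g"
proof -
  let ?X = "\<lambda>\<omega>. f (Y \<omega>)"
  have g': "bounded_rv M g" using F g by (rule bounded_rv_subalgebra)
  have "{?X -` A \<inter> space M |A. A \<in> sets borel} \<subseteq> sets (vimage_algebra (space M) Y borel)"
  proof safe
    fix A :: "real set" assume "A \<in> sets borel"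
    then have "f -` A \<in> sets borel" using f(1) measurable_sets[of f borel borel A] by simp
    then have "Y -` (f -` A) \<inter> space M \<in> sets (vimage_algebra (space M) Y borel)"
      by (rule in_vimage_algebra)
    then show "?X -` A \<inter> space M \<in> sets (vimage_algebra (space M) Y borel)"
      by (simp add: vimage_def)
  qed
  then have X: "sigma_sets (space M) {?X -` A \<inter> space M |A. A \<in> sets borel} \<subseteq> sets (vimage_algebra (space M) Y borel)"
    using sets.sigma_sets_subset[of _ "vimage_algebra (space M) Y borel"] by simp
  have "{g -` A \<inter> space M |A. A \<in> sets borel} \<subseteq> sets F"
    using F bounded_rv_measurable[OF g] by (auto simp: subalgebra_def measurable_def)
  then have G: "sigma_sets (space M) {g -` A \<inter> space M |A. A \<in> sets borel} \<subseteq> sets F"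
    using sets.sigma_sets_subset[of _ F] F by (simp add: subalgebra_def)
  have "indep_var borel ?X borel g"
    unfolding indep_var_eq
  proof (intro conjI bounded_rv_measurable f(2) g')
    show "indep_set (sigma_sets (space M) {?X -` A \<inter> space M |A. A \<in> sets borel})
        (sigma_sets (space M) {g -` A \<inter> space M |A. A \<in> sets borel})"
      using ind unfolding indep_set_def
      by (rule indep_sets_mono_sets) (use X G in \<open>auto split: bool.splits\<close>)
  qed
  then show ?thesis
    by (intro indep_var_lebesgue_integral bounded_rv_integrable f(2) g')
qed

section \<open>Mean arrivals and arrival rates\<close>

lemma arrival_bounds:
  assumes "arrival_process M A A_max" "1 \<le> t"
  shows "\<omega> \<in> space M \<Longrightarrow> 0 \<le> A t \<omega> $ n $ k" "\<omega> \<in> space M \<Longrightarrow> A t \<omega> $ n $ k \<le> A_max $ n $ k"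
  using assms unfolding arrival_process_def by auto

lemma arrival_bounded_rv:
  assumes M: "prob_space M" and A: "arrival_process M A A_max" and t: "1 \<le> t"
  shows "bounded_rv M (\<lambda>\<omega>. A t \<omega> $ n $ k)"
  unfolding bounded_rv_def
proof
  interpret prob_space M by fact
  show "(\<lambda>\<omega>. A t \<omega> $ n $ k) \<in> borel_measurable M"
    using A t unfolding arrival_process_def indep_vars_def by auto
  show "\<exists>B. \<forall>x\<in>space M. \<bar>A t x $ n $ k\<bar> \<le> B"
    using arrival_bounds[OF A t, of _ n k] by (intro exI[of _ "A_max $ n $ k"]) auto
qed

lemma arrival_expectation:
  assumes M: "prob_space M" and A: "arrival_process M A A_max" and t: "1 \<le> t"
  shows "(\<integral>\<omega>. A t \<omega> $ n $ k \<partial>M) = (\<integral>\<omega>. A 1 \<omega> $ n $ k \<partial>M)"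
proof -
  have eq: "distr M borel (\<lambda>\<omega>. A t \<omega> $ n $ k) = distr M borel (\<lambda>\<omega>. A 1 \<omega> $ n $ k)"
    using A t unfolding arrival_process_def by blast
  have "(\<integral>x. x \<partial>distr M borel (\<lambda>\<omega>. A t \<omega> $ n $ k)) = (\<integral>\<omega>. A t \<omega> $ n $ k \<partial>M)" if "1 \<le> t" for t
    using bounded_rv_measurable[OF arrival_bounded_rv[OF M A that, of n k]] by (intro integral_distr) auto
  from this[OF t] this[of 1] eq show ?thesis by simp
qed

text \<open>Dominated convergence suffices for the inequality; equality would need a law of large numbers.\<close>

lemma arrival_expectation_le_rate:
  assumes M: "prob_space M" and A: "arrival_process M A A_max" and rates: "has_arrival_rates M A lam"
  shows "(\<integral>\<omega>. A 1 \<omega> $ n $ k \<partial>M) \<le> lam $ n $ k"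
proof (rule ccontr)
  interpret prob_space M by fact
  define m where "m = (\<integral>\<omega>. A 1 \<omega> $ n $ k \<partial>M)"
  assume "\<not> ?thesis"
  then have "lam $ n $ k < m" by (simp add: m_def)
  then obtain c where c: "lam $ n $ k < c" "c < m" using dense by blast
  define X where "X t \<omega> = (1 / real t) * (\<Sum>\<tau>=1..t. A \<tau> \<omega> $ n $ k)" for t \<omega>
  have X: "bounded_rv M (X t)" for t
    unfolding X_def by (intro bounded_rv_intros arrival_bounded_rv[OF M A]) auto
  have X0: "0 \<le> X t \<omega>" "X t \<omega> \<le> A_max $ n $ k" if "\<omega> \<in> space M" "1 \<le> t" for t \<omega>
  proof -
    show "0 \<le> X t \<omega>" using that arrival_bounds[OF A] unfolding X_def
      by (intro mult_nonneg_nonneg sum_nonneg) auto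
    have "(\<Sum>\<tau>=1..t. A \<tau> \<omega> $ n $ k) \<le> (\<Sum>\<tau>=1..t. A_max $ n $ k)"
      using that by (intro sum_mono arrival_bounds(2)[OF A]) auto
    then show "X t \<omega> \<le> A_max $ n $ k" using that by (simp add: X_def field_simps)
  qed
  have EX: "expectation (X t) = m" if "1 \<le> t" for t
  proof -
    have "expectation (X t) = (1 / real t) * (\<Sum>\<tau>=1..t. expectation (\<lambda>\<omega>. A \<tau> \<omega> $ n $ k))"
      unfolding X_def
      by (simp add: Bochner_Integration.integral_sum bounded_rv_integrable arrival_bounded_rv[OF M A])
    also have "\<dots> = (1 / real t) * (\<Sum>\<tau>=1..t. m)"
      unfolding m_def by (intro arg_cong2[where f="(*)"] sum.cong refl arrival_expectation[OF M A]) auto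
    finally show ?thesis using that by simp
  qed
  \<comment> \<open>Almost surely the averages end up below \<open>c\<close>, so \<open>Y\<close>
    tends to 0, yet its mean stays above \<open>m - c > 0\<close>. The shift by one slot avoids the
    empty average, whose expectation is not \<open>m\<close>.\<close>
  define Y where "Y t \<omega> = max 0 (X (Suc t) \<omega> - c)" for t \<omega>
  have Ym: "Y t \<in> borel_measurable M" for t
    using bounded_rv_measurable[OF X] unfolding Y_def by measurable
  have "AE \<omega> in M. (\<lambda>t. Y t \<omega>) \<longlonglongrightarrow> 0"
    using rates unfolding has_arrival_rates_def
  proof eventually_elim
    case (elim \<omega>)
    then have "limsup (\<lambda>t. ereal (X t \<omega>)) < ereal c"
      unfolding X_def using c by simp
    then have "\<forall>\<^sub>F t in sequentially. ereal (X t \<omega>) < ereal c" by (rule Limsup_lessD)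
    then have "\<forall>\<^sub>F t in sequentially. ereal (X (Suc t) \<omega>) < ereal c"
      by (subst eventually_sequentially_Suc)
    then have "\<forall>\<^sub>F t in sequentially. Y t \<omega> = 0"
      by eventually_elim (simp add: Y_def)
    then show ?case by (rule tendsto_eventually)
  qed
  moreover have Yb: "norm (Y t \<omega>) \<le> \<bar>A_max $ n $ k\<bar> + \<bar>c\<bar>" if "\<omega> \<in> space M" for t \<omega>
    using X0[OF that, of "Suc t"] by (auto simp: Y_def)
  ultimately have lim: "(\<lambda>t. expectation (Y t)) \<longlonglongrightarrow> expectation (\<lambda>_. 0)"
    by (intro integral_dominated_convergence[where w="\<lambda>_. \<bar>A_max $ n $ k\<bar> + \<bar>c\<bar>"] Ym) auto
  have ge: "m - c \<le> expectation (Y t)" for t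
  proof -
    have int: "integrable M (\<lambda>\<omega>. X (Suc t) \<omega> - c)"
      by (intro bounded_rv_integrable bounded_rv_intros X)
    have "m - c = expectation (\<lambda>\<omega>. X (Suc t) \<omega> - c)"
      using EX[of "Suc t"] bounded_rv_integrable[OF X, of "Suc t"] by (simp add: prob_space)
    also have "\<dots> \<le> expectation (Y t)"
    proof (rule integral_mono[OF int])
      show "integrable M (Y t)" by (rule integrable_const_bound[OF AE_I2[OF Yb] Ym])
    qed (simp add: Y_def)
    finally show ?thesis .
  qed
  have "m - c \<le> expectation (\<lambda>_. 0)"
    by (rule LIMSEQ_le_const[OF lim]) (use ge in blast)
  then show False using c by simp
qed

section \<open>Expected drift and time averages\<close>

text \<open>In \<open>queue_step\<close> the arrivals multiply a quantity known at the beginning of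
  the slot, so in expectation they are replaced by \<open>m\<close>. Then
  \<open>2 * m * (i - c)\<close> cancels against \<open>2 * m * (o' + c - i)\<close> and only
  \<open>2 * m * o'\<close> remains, which \<open>second_order_bound\<close> absorbs. The terms
  linear in the queue lengths are handled pointwise by
  \<open>efc_serves_stability_region\<close>.\<close>

lemma efc_drift:
  fixes G :: "('n::finite, 'k::finite) vip_network"
  assumes G: "vip_network G" and M: "prob_space M"
    and A: "arrival_process M A A_max" and rates: "has_arrival_rates M A lam"
    and \<eta>: "\<And>n n' k v. \<eta> n n' k v \<in> {0..1}" and z: "\<And>n k. 0 < z n k"
    and efc: "efc_process G \<eta> z M F A \<mu> s V"
    and lam': "lam' \<in> stability_region G" "\<And>n k. \<gamma> \<le> lam' $ n $ k - lam $ n $ k - eps_z G z $ n $ k"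
    and m: "\<And>n k. m n k = (\<integral>\<omega>. A 1 \<omega> $ n $ k \<partial>M)"
  shows "1 \<le> t \<Longrightarrow> bounded_rv M (\<lambda>\<omega>. V t \<omega> $ n $ k)"
    and "1 \<le> t \<Longrightarrow> (\<Sum>n\<in>UNIV. \<Sum>k\<in>UNIV. \<integral>\<omega>. (V (Suc t) \<omega> $ n $ k)\<^sup>2 - 2 * m n k * V (Suc t) \<omega> $ n $ k \<partial>M)
       \<le> (\<Sum>n\<in>UNIV. \<Sum>k\<in>UNIV. \<integral>\<omega>. (V t \<omega> $ n $ k)\<^sup>2 - 2 * m n k * V t \<omega> $ n $ k \<partial>M)
         + 2 * (real CARD('n) * bound_B G A_max)
         - 2 * \<gamma> * (\<Sum>n\<in>UNIV. \<Sum>k\<in>UNIV. \<integral>\<omega>. V t \<omega> $ n $ k \<partial>M)"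
proof -
  interpret prob_space M by fact
  define out where "out t n k \<omega> = (\<Sum>b\<in>UNIV. \<mu> t \<omega> n b k)" for t n k \<omega>
  define inn where "inn t n k \<omega> = (\<Sum>a\<in>UNIV. \<mu> t \<omega> a n k)" for t n k \<omega>
  define c where "c t n k \<omega> = cache_rate G n * s t \<omega> n k" for t n k \<omega>
  define W where "W t n k \<omega> = V t \<omega> $ n $ k" for t n k \<omega>
  have sub: "subalgebra M (F t)" for t using efc by (simp add: efc_process_def)
  then have spF: "space (F t) = space M" for t by (simp add: subalgebra_def)
  have meas: "V t \<in> borel_measurable (F t)" "(\<lambda>\<omega>. \<mu> t \<omega> a b k) \<in> borel_measurable (F t)"
    "(\<lambda>\<omega>. s t \<omega> n k) \<in> borel_measurable (F t)"
    "indep_set (sets (vimage_algebra (space M) (A t) borel)) (sets (F t))" if "1 \<le> t" for t a b n k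
    using efc that unfolding efc_process_def by auto
  have act: "efc_forwarding G \<eta> z (V t \<omega>) (\<mu> t \<omega>)" "efc_caching G \<eta> z (V t \<omega>) (s t \<omega>)"
    if "1 \<le> t" "\<omega> \<in> space M" for t \<omega>
    using efc that unfolding efc_process_def by auto
  have dyn: "vip_dynamics G (\<lambda>t. A t \<omega>) (\<lambda>t. \<mu> t \<omega>) (\<lambda>t. s t \<omega>) (\<lambda>t. V t \<omega>)" if "\<omega> \<in> space M" for \<omega>
    using efc that unfolding efc_process_def by auto
  have V1: "W 1 n k \<omega> = 0" if "\<omega> \<in> space M" for n k \<omega>
    using dyn[OF that] unfolding vip_dynamics_def W_def by auto
  have V0: "0 \<le> W t n k \<omega>" if "\<omega> \<in> space M" "1 \<le> t" for t n k \<omega>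
    using dyn[OF that(1)] that(2) unfolding vip_dynamics_def W_def by auto
  have Vsrc: "W t (src G k) k \<omega> = 0" if "\<omega> \<in> space M" "1 \<le> t" for t k \<omega>
    using dyn[OF that(1)] that(2) unfolding vip_dynamics_def W_def by auto
  have VS: "W (Suc t) n k \<omega> \<le> max 0 (max 0 (W t n k \<omega> - out t n k \<omega>) + A t \<omega> $ n $ k + inn t n k \<omega> - c t n k \<omega>)"
    if "\<omega> \<in> space M" "1 \<le> t" for t n k \<omega>
    using dyn[OF that(1)] that(2) unfolding vip_dynamics_def W_def out_def inn_def c_def by blast
  have feas: "feasible_forwarding G (\<mu> t \<omega>)" if "1 \<le> t" "\<omega> \<in> space M" for t \<omega>
    by (rule efc_forwarding_feasible[OF G act(1)[OF that]])
  have s: "0 \<le> s t \<omega> n k" "s t \<omega> n k \<le> 1" if "1 \<le> t" "\<omega> \<in> space M" for t \<omega> n k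
  proof -
    have "s t \<omega> n k \<in> {0, 1}"
      using act(2)[OF that] unfolding efc_caching_def is_arg_max_def feasible_caching_at_def by blast
    then show "0 \<le> s t \<omega> n k" "s t \<omega> n k \<le> 1" by auto
  qed
  have r: "0 \<le> cache_rate G n" for n using G by (simp add: vip_network_def)
  have \<mu>0: "0 \<le> \<mu> t \<omega> a b k" if "1 \<le> t" "\<omega> \<in> space M" for t \<omega> a b k
    using feas[OF that] by (simp add: feasible_forwarding_def)
  have \<mu>C: "\<mu> t \<omega> a b k \<le> cap G b a / obj_size G" if "1 \<le> t" "\<omega> \<in> space M" for t \<omega> a b k
    using member_le_sum[of k UNIV "\<mu> t \<omega> a b"] \<mu>0[OF that] feasible_forwarding_le[OF G feas[OF that], of a b] by simp
  have nonneg: "0 \<le> out t n k \<omega>" "0 \<le> inn t n k \<omega>" "0 \<le> c t n k \<omega>" if "1 \<le> t" "\<omega> \<in> space M" for t \<omega> n k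
    using \<mu>0[OF that] r s[OF that] unfolding out_def inn_def c_def by (auto intro!: sum_nonneg)
  have b\<mu>: "bounded_rv (F t) (\<lambda>\<omega>. \<mu> t \<omega> a b k)" if "1 \<le> t" for t a b k
    unfolding bounded_rv_def spF using meas(2)[OF that] \<mu>0[OF that] \<mu>C[OF that]
    by (auto intro!: exI[of _ "cap G b a / obj_size G"])
  have bs: "bounded_rv (F t) (\<lambda>\<omega>. s t \<omega> n k)" if "1 \<le> t" for t n k
    unfolding bounded_rv_def spF using meas(3)[OF that] s[OF that]
    by (auto intro!: exI[of _ 1])
  have bact: "bounded_rv (F t) (out t n k)" "bounded_rv (F t) (inn t n k)" "bounded_rv (F t) (c t n k)" if "1 \<le> t" for t n k
    unfolding out_def inn_def c_def by (intro bounded_rv_intros b\<mu> bs that)+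
  \<comment> \<open>One slot adds at most the arrival bound and the inflow bound. The resulting
    bound depends on \<open>t\<close>, so it yields integrability in each slot but nothing uniform
    in time.\<close>
  have W_le: "\<exists>B. \<forall>\<omega>\<in>space M. W t n k \<omega> \<le> B" if "1 \<le> t" for t n k
    using that
  proof (induction t rule: dec_induct)
    case base
    then show ?case using V1 by (intro exI[of _ 0]) auto
  next
    case (step t)
    obtain B where B: "W t n k \<omega> \<le> B" if "\<omega> \<in> space M" for \<omega> using step by blast
    obtain B' where B': "\<bar>inn t n k \<omega>\<bar> \<le> B'" if "\<omega> \<in> space M" for \<omega>
      using bact(2)[of t n k] step unfolding bounded_rv_def spF by auto
    have "W (Suc t) n k \<omega> \<le> B + \<bar>A_max $ n $ k\<bar> + B'" if "\<omega> \<in> space M" for \<omega>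
      using VS[OF that, of t n k] step B[OF that] B'[OF that] nonneg[OF _ that, of t n k] V0[OF that, of t n k]
        arrival_bounds[OF A _ that, of t n k] by auto
    then show ?case by blast
  qed
  have bW: "bounded_rv (F t) (W t n k)" if t: "1 \<le> t" for t n k
    unfolding bounded_rv_def spF
  proof
    show "W t n k \<in> borel_measurable (F t)"
      unfolding W_def by (rule borel_measurable_vec_nth2[OF meas(1)[OF t]])
    obtain B where "W t n k \<omega> \<le> B" if "\<omega> \<in> space M" for \<omega> using W_le[OF t] by blast
    then show "\<exists>B. \<forall>\<omega>\<in>space M. \<bar>W t n k \<omega>\<bar> \<le> B"
      using V0[OF _ t, of _ n k] by (intro exI[of _ B]) auto
  qed
  show "bounded_rv M (\<lambda>\<omega>. V t \<omega> $ n $ k)" if "1 \<le> t" for t n k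
    using bounded_rv_subalgebra[OF sub bW[OF that, of n k]] by (simp add: W_def[abs_def])
  assume t: "1 \<le> t"
  have mE: "m n k = expectation (\<lambda>\<omega>. A t \<omega> $ n $ k)" for n k
    by (simp only: m arrival_expectation[OF M A t])
  have m0: "0 \<le> m n k" for n k
    unfolding mE by (rule integral_nonneg_AE) (use arrival_bounds[OF A t] in auto)
  have mA: "m n k \<le> A_max $ n $ k" for n k
    unfolding mE by (intro integral_le_const bounded_rv_integrable arrival_bounded_rv[OF M A t] AE_I2 arrival_bounds(2)[OF A t])
  have mlam: "m n k \<le> lam $ n $ k" for n k
    unfolding m by (rule arrival_expectation_le_rate[OF M A rates])
  note toM = bounded_rv_subalgebra[OF sub]
  note int = bounded_rv_integrable[OF toM]
  have bA: "bounded_rv M (\<lambda>\<omega>. A t \<omega> $ n $ k)" for n k by (rule arrival_bounded_rv[OF M A t])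
  have A2: "expectation (\<lambda>\<omega>. (A t \<omega> $ n $ k)\<^sup>2) \<le> (A_max $ n $ k)\<^sup>2" for n k
    by (intro integral_le_const bounded_rv_integrable bounded_rv_intros bA AE_I2 power_mono arrival_bounds[OF A t])
  define q where "q n k \<omega> = (out t n k \<omega>)\<^sup>2 + 2 * out t n k \<omega> * c t n k \<omega>
      + (inn t n k \<omega> - c t n k \<omega>)\<^sup>2 + 2 * m n k * out t n k \<omega>" for n k \<omega>
  define d where "d n k \<omega> = 2 * W t n k \<omega> * (m n k + inn t n k \<omega> - out t n k \<omega> - c t n k \<omega>)" for n k \<omega>
  have bq: "bounded_rv (F t) (q n k)" for n k
    unfolding q_def by (intro bounded_rv_intros bact t)
  have bd: "bounded_rv (F t) (d n k)" for n k
    unfolding d_def by (intro bounded_rv_intros bW bact t)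
  have step: "expectation (\<lambda>\<omega>. (W (Suc t) n k \<omega>)\<^sup>2 - 2 * m n k * W (Suc t) n k \<omega>)
      \<le> expectation (\<lambda>\<omega>. (W t n k \<omega>)\<^sup>2 - 2 * m n k * W t n k \<omega>) + expectation (d n k)
        + ((A_max $ n $ k)\<^sup>2 + expectation (q n k))" for n k
  proof -
    let ?H = "\<lambda>\<omega>. 2 * W t n k \<omega> + 2 * inn t n k \<omega> - 2 * c t n k \<omega> - 2 * m n k"
    let ?a = "\<lambda>\<omega>. A t \<omega> $ n $ k"
    let ?R = "\<lambda>\<omega>. (W t n k \<omega>)\<^sup>2 - 2 * m n k * W t n k \<omega> + 2 * W t n k \<omega> * (inn t n k \<omega> - out t n k \<omega> - c t n k \<omega>)
       + (out t n k \<omega>)\<^sup>2 + 2 * out t n k \<omega> * c t n k \<omega> + (inn t n k \<omega> - c t n k \<omega>)\<^sup>2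
       + 2 * m n k * (out t n k \<omega> + c t n k \<omega> - inn t n k \<omega>) + (m n k)\<^sup>2"
    have bH: "bounded_rv (F t) ?H" by (intro bounded_rv_intros bW bact t)
    have bR: "bounded_rv (F t) ?R" by (intro bounded_rv_intros bW bact t)
    have bL: "bounded_rv (F t) (\<lambda>\<omega>. (W t n k \<omega>)\<^sup>2 - 2 * m n k * W t n k \<omega>)"
      by (intro bounded_rv_intros bW t)
    have aH: "expectation (\<lambda>\<omega>. ?a \<omega> * ?H \<omega>) = m n k * expectation ?H"
      by (rule trans[OF expectation_mult_indep_subalgebra[OF sub meas(4)[OF t] _ _ bH, of "\<lambda>v. v $ n $ k"]])
         (auto intro!: bA borel_measurable_vec_nth2 simp: mE[symmetric])
    have iaH: "integrable M (\<lambda>\<omega>. ?a \<omega> * ?H \<omega>)" and ia2: "integrable M (\<lambda>\<omega>. (?a \<omega>)\<^sup>2)"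
      by (intro bounded_rv_integrable bounded_rv_mult[OF _ toM[OF bH]] bounded_rv_power2 bA)+
    have "expectation (\<lambda>\<omega>. (W (Suc t) n k \<omega>)\<^sup>2 - 2 * m n k * W (Suc t) n k \<omega>)
       \<le> expectation (\<lambda>\<omega>. ?R \<omega> + ?a \<omega> * ?H \<omega> + (?a \<omega>)\<^sup>2)"
    proof (rule integral_mono)
      show "integrable M (\<lambda>\<omega>. (W (Suc t) n k \<omega>)\<^sup>2 - 2 * m n k * W (Suc t) n k \<omega>)"
        by (intro int[of "Suc t"] bounded_rv_intros bW) simp_all
      show "integrable M (\<lambda>\<omega>. ?R \<omega> + ?a \<omega> * ?H \<omega> + (?a \<omega>)\<^sup>2)"
        by (rule Bochner_Integration.integrable_add[OF Bochner_Integration.integrable_add[OF int[OF bR] iaH] ia2])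
      fix \<omega> assume \<omega>: "\<omega> \<in> space M"
      show "(W (Suc t) n k \<omega>)\<^sup>2 - 2 * m n k * W (Suc t) n k \<omega> \<le> ?R \<omega> + ?a \<omega> * ?H \<omega> + (?a \<omega>)\<^sup>2"
        using queue_step[OF V0[OF \<omega> t, of n k] V0[OF \<omega>, of "Suc t" n k] arrival_bounds(1)[OF A t \<omega>, of n k]
            nonneg(2)[OF t \<omega>, of n k] nonneg(3)[OF t \<omega>, of n k] m0[of n k] nonneg(1)[OF t \<omega>, of n k] VS[OF \<omega> t, of n k]]
        by simp
    qed
    also have "\<dots> = expectation ?R + m n k * expectation ?H + expectation (\<lambda>\<omega>. (?a \<omega>)\<^sup>2)"
      using Bochner_Integration.integral_add[OF Bochner_Integration.integrable_add[OF int[OF bR] iaH] ia2]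
        Bochner_Integration.integral_add[OF int[OF bR] iaH] aH by (simp only:)
    also have "\<dots> \<le> expectation ?R + m n k * expectation ?H + (A_max $ n $ k)\<^sup>2"
      using A2[of n k] by simp
    also have "expectation ?R + m n k * expectation ?H = expectation (\<lambda>\<omega>. ?R \<omega> + m n k * ?H \<omega>)"
      using int[OF bR] int[OF bH] by simp
    also have "\<dots> = expectation (\<lambda>\<omega>. (W t n k \<omega>)\<^sup>2 - 2 * m n k * W t n k \<omega> + d n k \<omega> + (q n k \<omega> - (m n k)\<^sup>2))"
      by (intro Bochner_Integration.integral_cong refl) (simp add: d_def q_def power2_eq_square algebra_simps)
    also have "\<dots> \<le> expectation (\<lambda>\<omega>. (W t n k \<omega>)\<^sup>2 - 2 * m n k * W t n k \<omega> + d n k \<omega> + q n k \<omega>)"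
      by (intro integral_mono int[of t] bounded_rv_add[OF bounded_rv_add[OF bL bd]] bounded_rv_diff bq bounded_rv_const) simp
    also have "\<dots> = expectation (\<lambda>\<omega>. (W t n k \<omega>)\<^sup>2 - 2 * m n k * W t n k \<omega>) + expectation (d n k) + expectation (q n k)"
      using int[OF bL] int[OF bd] int[OF bq] by (simp only: Bochner_Integration.integral_add Bochner_Integration.integrable_add)
    finally show ?thesis by simp
  qed
  have drift: "(\<Sum>n\<in>UNIV. \<Sum>k\<in>UNIV. d n k \<omega>) + (\<Sum>n\<in>UNIV. \<Sum>k\<in>UNIV. (A_max $ n $ k)\<^sup>2 + q n k \<omega>)
      \<le> 2 * (real CARD('n) * bound_B G A_max) - 2 * \<gamma> * (\<Sum>n\<in>UNIV. \<Sum>k\<in>UNIV. W t n k \<omega>)" if \<omega>: "\<omega> \<in> space M" for \<omega>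
  proof -
    have q: "(\<Sum>n\<in>UNIV. \<Sum>k\<in>UNIV. (A_max $ n $ k)\<^sup>2 + q n k \<omega>) \<le> 2 * (real CARD('n) * bound_B G A_max)"
      unfolding q_def out_def inn_def c_def
      by (intro second_order_bound G feas s t \<omega> m0 mA)
    \<comment> \<open>The margin \<open>\<gamma>\<close> is what remains of \<open>lam'\<close>
      after the load and the penalty \<open>eps_z\<close>; that penalty cancels against the loss in
      the next step. Nonnegative queue lengths allow \<open>m\<close> to be compared with
      \<open>lam\<close> termwise.\<close>
    have "(\<Sum>n\<in>UNIV. \<Sum>k\<in>UNIV. W t n k \<omega> * (m n k + \<gamma> + eps_z G z $ n $ k)) \<le> (\<Sum>n\<in>UNIV. \<Sum>k\<in>UNIV. W t n k \<omega> * lam' $ n $ k)"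
    proof (intro sum_mono mult_left_mono)
      show "m n k + \<gamma> + eps_z G z $ n $ k \<le> lam' $ n $ k" for n k
        using mlam[of n k] lam'(2)[of n k] by linarith
    qed (rule V0[OF \<omega> t])
    also have "\<dots> \<le> (\<Sum>n\<in>UNIV. \<Sum>k\<in>UNIV. W t n k \<omega> * (out t n k \<omega> - inn t n k \<omega> + c t n k \<omega>))
       + (\<Sum>n\<in>UNIV. \<Sum>k\<in>UNIV. W t n k \<omega> * eps_z G z $ n $ k)"
      unfolding W_def out_def inn_def c_def
      by (rule efc_serves_stability_region[OF G \<eta> z _ _ act[OF t \<omega>] lam'(1)])
         (use V0[OF \<omega> t] Vsrc[OF \<omega> t] in \<open>auto simp: W_def\<close>)
    finally have "(\<Sum>n\<in>UNIV. \<Sum>k\<in>UNIV. d n k \<omega>) \<le> - 2 * \<gamma> * (\<Sum>n\<in>UNIV. \<Sum>k\<in>UNIV. W t n k \<omega>)"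
      by (simp add: d_def algebra_simps sum.distrib sum_subtractf flip: sum_distrib_left)
    with q show ?thesis by linarith
  qed
  have "(\<Sum>n\<in>UNIV. \<Sum>k\<in>UNIV. expectation (\<lambda>\<omega>. (W (Suc t) n k \<omega>)\<^sup>2 - 2 * m n k * W (Suc t) n k \<omega>))
      \<le> (\<Sum>n\<in>UNIV. \<Sum>k\<in>UNIV. expectation (\<lambda>\<omega>. (W t n k \<omega>)\<^sup>2 - 2 * m n k * W t n k \<omega>) + expectation (d n k)
        + ((A_max $ n $ k)\<^sup>2 + expectation (q n k)))"
    by (intro sum_mono step)
  also have "\<dots> = (\<Sum>n\<in>UNIV. \<Sum>k\<in>UNIV. expectation (\<lambda>\<omega>. (W t n k \<omega>)\<^sup>2 - 2 * m n k * W t n k \<omega>))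
      + expectation (\<lambda>\<omega>. (\<Sum>n\<in>UNIV. \<Sum>k\<in>UNIV. d n k \<omega>) + (\<Sum>n\<in>UNIV. \<Sum>k\<in>UNIV. (A_max $ n $ k)\<^sup>2 + q n k \<omega>))"
    using int[OF bd] int[OF bq] by (simp add: sum.distrib prob_space)
  also have "expectation (\<lambda>\<omega>. (\<Sum>n\<in>UNIV. \<Sum>k\<in>UNIV. d n k \<omega>) + (\<Sum>n\<in>UNIV. \<Sum>k\<in>UNIV. (A_max $ n $ k)\<^sup>2 + q n k \<omega>))
      \<le> expectation (\<lambda>\<omega>. 2 * (real CARD('n) * bound_B G A_max) - 2 * \<gamma> * (\<Sum>n\<in>UNIV. \<Sum>k\<in>UNIV. W t n k \<omega>))"
    by (intro integral_mono drift int[of t] bounded_rv_intros bd bq bW t)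
  also have "\<dots> = 2 * (real CARD('n) * bound_B G A_max) - 2 * \<gamma> * (\<Sum>n\<in>UNIV. \<Sum>k\<in>UNIV. expectation (W t n k))"
    using int[OF bW[OF t]] by (simp add: prob_space)
  finally show "(\<Sum>n\<in>UNIV. \<Sum>k\<in>UNIV. \<integral>\<omega>. (V (Suc t) \<omega> $ n $ k)\<^sup>2 - 2 * m n k * V (Suc t) \<omega> $ n $ k \<partial>M)
       \<le> (\<Sum>n\<in>UNIV. \<Sum>k\<in>UNIV. \<integral>\<omega>. (V t \<omega> $ n $ k)\<^sup>2 - 2 * m n k * V t \<omega> $ n $ k \<partial>M)
         + 2 * (real CARD('n) * bound_B G A_max)
         - 2 * \<gamma> * (\<Sum>n\<in>UNIV. \<Sum>k\<in>UNIV. \<integral>\<omega>. V t \<omega> $ n $ k \<partial>M)"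
    by (simp add: W_def[abs_def])
qed

text \<open>Telescoping the drift leaves the final Lyapunov value, which can be negative here.
  Completing the square bounds it below by \<open>- C\<close>, the negated sum of the squared means,
  and this constant disappears after division by \<open>t\<close>.\<close>

lemma efc_time_average_bound:
  fixes G :: "('n::finite, 'k::finite) vip_network"
  assumes G: "vip_network G" and M: "prob_space M"
    and A: "arrival_process M A A_max" and rates: "has_arrival_rates M A lam"
    and \<eta>: "\<And>n n' k v. \<eta> n n' k v \<in> {0..1}" and z: "\<And>n k. 0 < z n k"
    and efc: "efc_process G \<eta> z M F A \<mu> s V"
    and lam': "lam' \<in> stability_region G" "\<And>n k. \<gamma> \<le> lam' $ n $ k - lam $ n $ k - eps_z G z $ n $ k"
    and \<gamma>: "0 < \<gamma>"
  shows "limsup (\<lambda>t. ereal ((1 / real t) *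
            (\<Sum>\<tau>=1..t. \<Sum>n\<in>UNIV. \<Sum>k\<in>UNIV. integral\<^sup>L M (\<lambda>\<omega>. V \<tau> \<omega> $ n $ k))))
          \<le> ereal (real CARD('n) * bound_B G A_max / \<gamma>)"
proof -
  interpret prob_space M by fact
  define m where "m n k = (\<integral>\<omega>. A 1 \<omega> $ n $ k \<partial>M)" for n k
  define B where "B = real CARD('n) * bound_B G A_max"
  define S where "S t = (\<Sum>n\<in>UNIV. \<Sum>k\<in>UNIV. \<integral>\<omega>. V t \<omega> $ n $ k \<partial>M)" for t
  define \<Phi> where "\<Phi> t = (\<Sum>n\<in>UNIV. \<Sum>k\<in>UNIV. \<integral>\<omega>. (V t \<omega> $ n $ k)\<^sup>2 - 2 * m n k * V t \<omega> $ n $ k \<partial>M)" for t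
  define C where "C = (\<Sum>n\<in>UNIV. \<Sum>k\<in>UNIV. (m n k)\<^sup>2)"
  note * = efc_drift[OF G M A rates \<eta> z efc lam' m_def]
  have step: "\<Phi> (Suc t) \<le> \<Phi> t + 2 * B - 2 * \<gamma> * S t" if "1 \<le> t" for t
    using *(2)[OF that] by (simp add: \<Phi>_def B_def S_def)
  have "V 1 \<omega> $ n $ k = 0" if "\<omega> \<in> space M" for \<omega> n k
    using efc that unfolding efc_process_def vip_dynamics_def by blast
  then have \<Phi>1: "\<Phi> 1 = 0"
    unfolding \<Phi>_def by (simp cong: Bochner_Integration.integral_cong)
  have telescope: "2 * \<gamma> * (\<Sum>\<tau>=1..t. S \<tau>) \<le> 2 * B * real t - \<Phi> (Suc t)" for t
  proof (induction t)
    case 0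
    then show ?case using \<Phi>1 by simp
  next
    case (Suc t)
    then show ?case using step[of "Suc t"] by (simp add: algebra_simps)
  qed
  have \<Phi>_ge: "- C \<le> \<Phi> t" if "1 \<le> t" for t
  proof -
    have "- C = (\<Sum>n\<in>UNIV. \<Sum>k\<in>UNIV. \<integral>\<omega>. - (m n k)\<^sup>2 \<partial>M)"
      by (simp add: C_def sum_negf prob_space)
    also have "\<dots> \<le> \<Phi> t"
      unfolding \<Phi>_def
    proof (intro sum_mono integral_mono bounded_rv_integrable bounded_rv_intros *(1) that)
      show "- (m n k)\<^sup>2 \<le> (V t \<omega> $ n $ k)\<^sup>2 - 2 * m n k * V t \<omega> $ n $ k" for n k \<omega>
        using zero_le_power2[of "V t \<omega> $ n $ k - m n k"] by (simp add: power2_eq_square algebra_simps)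
    qed
    finally show ?thesis .
  qed
  have "(1 / real t) * (\<Sum>\<tau>=1..t. S \<tau>) \<le> B / \<gamma> + C / (2 * \<gamma>) / real t" if "1 \<le> t" for t
  proof -
    have "2 * \<gamma> * (\<Sum>\<tau>=1..t. S \<tau>) \<le> 2 * B * real t + C"
      using telescope[of t] \<Phi>_ge[of "Suc t"] by simp
    then show ?thesis using that \<gamma> by (simp add: field_simps)
  qed
  then have "limsup (\<lambda>t. ereal ((1 / real t) * (\<Sum>\<tau>=1..t. S \<tau>))) \<le> limsup (\<lambda>t. ereal (B / \<gamma> + C / (2 * \<gamma>) / real t))"
    by (intro Limsup_mono eventually_mono[OF eventually_ge_at_top[of 1]]) simp
  also have "\<dots> = ereal (B / \<gamma>)"
  proof (rule lim_imp_Limsup)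
    have "(\<lambda>t. B / \<gamma> + C / (2 * \<gamma>) / real t) \<longlonglongrightarrow> B / \<gamma> + 0"
      by (intro tendsto_add tendsto_const lim_const_over_n)
    then show "(\<lambda>t. ereal (B / \<gamma> + C / (2 * \<gamma>) / real t)) \<longlonglongrightarrow> ereal (B / \<gamma>)" by simp
  qed simp
  finally show ?thesis by (simp add: S_def B_def)
qed

section \<open>From a fixed margin to the supremum\<close>

lemma bound_B_nonneg:
  assumes G: "vip_network G" and M: "prob_space M" and A: "arrival_process M A A_max"
  shows "0 \<le> bound_B G A_max"
proof -
  interpret prob_space M by fact
  obtain \<omega> where \<omega>: "\<omega> \<in> space M" using not_empty by blast
  have "0 \<le> mu_out_max G n" for n
    unfolding mu_out_max_def sum_divide_distrib by (intro sum_nonneg cap_nonneg[OF G])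
  moreover have "0 \<le> cache_rate G n" for n using G by (simp add: vip_network_def)
  ultimately show ?thesis
    unfolding bound_B_def by (intro mult_nonneg_nonneg sum_nonneg add_nonneg_nonneg) auto
qed

text \<open>Every \<open>y\<close> with \<open>0 < y\<close> below the supremum is exceeded by some
  \<open>f i\<close>, so \<open>x\<close> is at most \<open>b / y\<close>; then \<open>y\<close>
  tends to the supremum from below. An infinite supremum forces \<open>x \<le> 0\<close>, which
  agrees with \<open>ereal b / \<infinity> = 0\<close>.\<close>

lemma le_divide_SUP_ereal:
  fixes f :: "'a \<Rightarrow> real"
  assumes b: "0 \<le> b" and le: "\<And>i. i \<in> I \<Longrightarrow> 0 < f i \<Longrightarrow> x \<le> ereal (b / f i)"
    and ex: "i0 \<in> I" "0 < f i0"
  shows "x \<le> ereal b / (SUP i\<in>I. ereal (f i))"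
proof -
  let ?S = "SUP i\<in>I. ereal (f i)"
  have "ereal (f i0) \<le> ?S" by (rule SUP_upper) fact
  then have pos: "0 < ?S" using ex(2) by (metis ereal_less(2) less_le_trans)
  have gt: "\<exists>i\<in>I. y < f i" if "ereal y < ?S" for y
    using that by (auto simp: less_SUP_iff)
  show ?thesis
  proof (cases ?S)
    case (real \<beta>)
    then have \<beta>: "0 < \<beta>" using pos by simp
    have "x \<le> ereal (b / y)" if y: "0 < y" "y < \<beta>" for y
    proof -
      obtain i where i: "i \<in> I" "y < f i" using gt[of y] y real by auto
      then have "x \<le> ereal (b / f i)" using y by (intro le) auto
      also have "\<dots> \<le> ereal (b / y)" using i y b by (auto intro!: divide_left_mono)
      finally show ?thesis .
    qed
    then have "\<forall>\<^sub>F y in at_left \<beta>. x \<le> ereal (b / y)"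
      using eventually_at_left_real[OF \<beta>] by (auto elim!: eventually_mono)
    moreover have "((\<lambda>y. ereal (b / y)) \<longlongrightarrow> ereal (b / \<beta>)) (at_left \<beta>)"
      using \<beta> by (intro tendsto_intros) auto
    ultimately have "x \<le> ereal (b / \<beta>)"
      by (intro tendsto_lowerbound) auto
    then show ?thesis using real \<beta> by simp
  next
    case PInf
    have "x \<le> ereal (b / y)" if y: "0 < y" for y
    proof -
      obtain i where i: "i \<in> I" "y < f i" using gt[of y] PInf by auto
      then have "x \<le> ereal (b / f i)" using y by (intro le) auto
      also have "\<dots> \<le> ereal (b / y)" using i y b by (auto intro!: divide_left_mono)
      finally show ?thesis .
    qed
    then have "\<forall>\<^sub>F y in at_top. x \<le> ereal (b / y)"
      by (intro eventually_mono[OF eventually_gt_at_top[of 0]])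
    moreover have "((\<lambda>y. ereal (b / y)) \<longlongrightarrow> ereal 0) at_top"
      by (intro tendsto_intros tendsto_divide_0[OF tendsto_const] filterlim_at_top_imp_at_infinity filterlim_ident)
    ultimately have "x \<le> ereal 0"
      by (intro tendsto_lowerbound) auto
    then show ?thesis using PInf by (simp add: zero_ereal_def)
  next
    case MInf
    then show ?thesis using pos by simp
  qed
qed

theorem theorem1:
  fixes G :: "('n::finite, 'k::finite) vip_network"
    and M :: "'w measure"
    and F :: "nat \<Rightarrow> 'w measure"
    and A V :: "nat \<Rightarrow> 'w \<Rightarrow> real^'k^'n"
    and \<mu> :: "nat \<Rightarrow> 'w \<Rightarrow> 'n \<Rightarrow> 'n \<Rightarrow> 'k \<Rightarrow> real"
    and s :: "nat \<Rightarrow> 'w \<Rightarrow> 'n \<Rightarrow> 'k \<Rightarrow> real"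
    and \<eta> :: "'n \<Rightarrow> 'n \<Rightarrow> 'k \<Rightarrow> real^'k^'n \<Rightarrow> real"
    and A_max lam eps :: "real^'k^'n"
  assumes "vip_network G"
    and "prob_space M"
    and "arrival_process M A A_max"
    and "has_arrival_rates M A lam"
    and "\<And>n n' k v. \<eta> n n' k v \<in> {0..1}"
    and "\<forall>n k. eps $ n $ k \<ge> 0"
    and "lam + eps \<in> interior (stability_region G)"
  shows "(\<exists>(del :: real^'k^'n) (z :: 'n \<Rightarrow> 'k \<Rightarrow> ereal).
            (\<forall>n k. del $ n $ k > 0) \<and> lam + eps + del \<in> stability_region G \<and>
            (\<forall>n k. z n k > 0) \<and> (\<forall>n k. eps_z G z $ n $ k \<le> eps $ n $ k)) \<and>
         (\<forall>(del :: real^'k^'n) (z :: 'n \<Rightarrow> 'k \<Rightarrow> ereal).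
            (\<forall>n k. del $ n $ k > 0) \<and> lam + eps + del \<in> stability_region G \<and>
            (\<forall>n k. z n k > 0) \<and> (\<forall>n k. eps_z G z $ n $ k \<le> eps $ n $ k) \<and>
            efc_process G \<eta> z M F A \<mu> s V \<longrightarrow>
            limsup (\<lambda>t. ereal ((1 / real t) *
                (\<Sum>\<tau>=1..t. \<Sum>n\<in>UNIV. \<Sum>k\<in>UNIV. integral\<^sup>L M (\<lambda>\<omega>. V \<tau> \<omega> $ n $ k))))
              \<le> ereal (real CARD('n) * bound_B G A_max) / beta_z G lam z)"
proof (intro conjI allI impI)
  obtain e where e: "0 < e" "ball (lam + eps) e \<subseteq> stability_region G"
    using assms(7) by (auto simp: mem_interior)
  define one :: "real^'k^'n" where "one = (\<chi> n k. 1)"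
  obtain N where N: "norm one \<le> N" "0 < N"
    using gt_ex[of "norm one"] by (meson less_imp_le le_less_trans norm_ge_zero)
  \<comment> \<open>As \<open>norm one \<le> N\<close>, the shift \<open>a *\<^sub>R one\<close> has
    norm at most \<open>e / 2\<close> and stays inside the ball.\<close>
  define a where "a = e / (2 * N)"
  have a: "0 < a" using e N by (simp add: a_def)
  have "norm (a *\<^sub>R one) < e"
  proof -
    have "a * norm one \<le> a * N" using a N by (intro mult_left_mono) auto
    also have "\<dots> < e" using e N by (simp add: a_def)
    finally show ?thesis using a by simp
  qed
  then have "lam + eps + a *\<^sub>R one \<in> ball (lam + eps) e"
    by (simp add: dist_norm)
  \<comment> \<open>Infinite parameters \<open>z\<close> switch the bias off and make
    \<open>eps_z\<close> vanish, so they are admissible for every nonnegative \<open>eps\<close>,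
    including zero.\<close>
  then show "\<exists>(del :: real^'k^'n) (z :: 'n \<Rightarrow> 'k \<Rightarrow> ereal).
            (\<forall>n k. del $ n $ k > 0) \<and> lam + eps + del \<in> stability_region G \<and>
            (\<forall>n k. z n k > 0) \<and> (\<forall>n k. eps_z G z $ n $ k \<le> eps $ n $ k)"
    using a e(2) assms(6)
    by (intro exI[of _ "a *\<^sub>R one"] exI[of _ "\<lambda>_ _. \<infinity>"]) (auto simp: one_def eps_z_def)
next
  fix del :: "real^'k^'n" and z :: "'n \<Rightarrow> 'k \<Rightarrow> ereal"
  assume *: "(\<forall>n k. del $ n $ k > 0) \<and> lam + eps + del \<in> stability_region G \<and>
            (\<forall>n k. z n k > 0) \<and> (\<forall>n k. eps_z G z $ n $ k \<le> eps $ n $ k) \<and>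
            efc_process G \<eta> z M F A \<mu> s V"
  define I where "I = {(eps', del'). (\<forall>n k. eps' $ n $ k > eps_z G z $ n $ k) \<and> (\<forall>n k. del' $ n $ k > 0) \<and>
                       lam + eps' + del' \<in> stability_region G}"
  define f where "f = (\<lambda>(eps', del'). MIN (n, k)\<in>UNIV. eps' $ n $ k + del' $ n $ k - eps_z G z $ n $ k)"
  have beta: "beta_z G lam z = (SUP p\<in>I. ereal (f p))"
    unfolding beta_z_def I_def f_def by (rule SUP_cong) auto
  \<comment> \<open>\<open>eps\<close> may coincide with \<open>eps_z\<close> in some entries, but
    the set in \<open>beta_z\<close> asks for strict inequality. Half of \<open>del\<close> is
    therefore moved into \<open>eps'\<close> and the other half stays as \<open>del'\<close>, which
    leaves the total load unchanged and gives an index with positive minimum.\<close>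
  define h where "h = (1 / 2) *\<^sub>R del"
  have h: "0 < h $ n $ k" for n k using * by (simp add: h_def)
  have eps_h: "eps_z G z $ n $ k < (eps + h) $ n $ k" for n k
  proof -
    have "eps_z G z $ n $ k \<le> eps $ n $ k" using * by blast
    then show ?thesis using h[of n k] by simp
  qed
  have hh: "lam + (eps + h) + h = lam + eps + del"
    by (simp add: h_def add.assoc flip: scaleR_add_left)
  show "limsup (\<lambda>t. ereal ((1 / real t) *
                (\<Sum>\<tau>=1..t. \<Sum>n\<in>UNIV. \<Sum>k\<in>UNIV. integral\<^sup>L M (\<lambda>\<omega>. V \<tau> \<omega> $ n $ k))))
              \<le> ereal (real CARD('n) * bound_B G A_max) / beta_z G lam z"
    unfolding beta
  proof (rule le_divide_SUP_ereal)
    show "0 \<le> real CARD('n) * bound_B G A_max"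
      using bound_B_nonneg[OF assms(1-3)] by simp
    show "(eps + h, h) \<in> I"
      unfolding I_def mem_Collect_eq prod.case hh using * h eps_h by blast
    have "0 < (eps + h) $ n $ k + h $ n $ k - eps_z G z $ n $ k" for n k
      using eps_h[of n k] h[of n k] by simp
    then show "0 < f (eps + h, h)"
      unfolding f_def prod.case by (subst Min_gr_iff) (simp_all add: case_prod_unfold)
    fix p assume p: "p \<in> I" "0 < f p"
    obtain eps' del' where p_eq: "p = (eps', del')" by (cases p)
    \<comment> \<open>The minimum \<open>f p\<close> is the margin \<open>\<gamma>\<close> for the
      load vector \<open>lam + eps' + del'\<close>.\<close>
    have "f p \<le> eps' $ n $ k + del' $ n $ k - eps_z G z $ n $ k" for n k
      unfolding f_def p_eq by (auto intro!: Min_le)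
    then show "limsup (\<lambda>t. ereal ((1 / real t) *
                (\<Sum>\<tau>=1..t. \<Sum>n\<in>UNIV. \<Sum>k\<in>UNIV. integral\<^sup>L M (\<lambda>\<omega>. V \<tau> \<omega> $ n $ k))))
              \<le> ereal (real CARD('n) * bound_B G A_max / f p)"
      using * p assms(1-5)
      by (intro efc_time_average_bound[where lam'="lam + eps' + del'" and lam=lam and \<eta>=\<eta> and z=z])
         (auto simp: I_def p_eq)
  qed
qed

end
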